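(* Let $\mathcal U,\mathcal Y$ be separable Hilbert spaces and let $F,G\in S(\mathcal U,\mathcal Y)$. Then $T_F\prec T_G$ if and only if there exists a bounded operator-valued function $Q$ on $\mathbb D$ (that is, $Q(\lambda)\in\mathcal L(\mathcal U,\mathcal Y)$ for each $\lambda\in\mathbb D$ and $\sup_{\lambda\in\mathbb D}\|Q(\lambda)\|<\infty$) such that $$F(\lambda)-G(\lambda)=D_{G(\lambda)^*}\,Q(\lambda)\,D_{G(\lambda)}\qquad(\lambda\in\mathbb D).$$
   Context: Operators are bounded linear maps between Hilbert spaces; $\mathcal L(\mathcal H_1,\mathcal H_2)$ is the space of operators and $\mathcal L_1(\mathcal H_1,\mathcal H_2)$ the set of contractions ($\|C\|\le 1$). For $C\in\mathcal L_1(\mathcal H_1,\mathcal H_2)$, the defect operator is $D_C=(I-C^*C)^{1/2}$ on $\mathcal H_1$ and the defect space is $\mathcal D_C=\overline{\mathrm{Ran}}\,D_C$. For contractions $A,B\in\mathcal L_1(\mathcal H_1,\mathcal H_2)$, $A\prec B$ means that $A-B=D_{B^*}XD_B$ for some $X\in\mathcal L(\mathcal D_B,\mathcal D_{B^*})$. $\mathbb D$ is the open unit disc. The Schur class $S(\mathcal U,\mathcal Y)$ consists of all analytic functions on $\mathbb D$ with values in $\mathcal L_1(\mathcal U,\mathcal Y)$. For $F\in S(\mathcal U,\mathcal Y)$, $T_F:H^2_{\mathcal U}\to H^2_{\mathcal Y}$ is the contraction $(T_Fh)(\lambda)=F(\lambda)h(\lambda)$ between the vector-valued Hardy spaces on $\mathbb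 D$. *)

theory Defs
  imports "HOL-Analysis.Analysis"
begin

section \<open>Complex normed spaces and complex Hilbert spaces\<close>

class complex_normed_vector = real_normed_vector +
  fixes scaleC :: "complex \<Rightarrow> 'a \<Rightarrow> 'a" (infixr \<open>*\<^sub>C\<close> 75)
  assumes scaleC_add_right: "c *\<^sub>C (x + y) = c *\<^sub>C x + c *\<^sub>C y"
    and scaleC_add_left: "(c + d) *\<^sub>C x = c *\<^sub>C x + d *\<^sub>C x"
    and scaleC_scaleC: "c *\<^sub>C d *\<^sub>C x = (c * d) *\<^sub>C x"
    and scaleR_scaleC: "r *\<^sub>R x = complex_of_real r *\<^sub>C x"
    and norm_scaleC: "norm (c *\<^sub>C x) = cmod c * norm x"

text \<open>The real inner product (hence norm, topology and completeness) is the one of the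
  library; the complex one is linear in the first argument and has it as its real part.\<close>

class complex_hilbert = complex_normed_vector + real_inner + complete_space +
  fixes cinner :: "'a \<Rightarrow> 'a \<Rightarrow> complex"
  assumes cinner_commute: "cinner x y = cnj (cinner y x)"
    and cinner_add_left: "cinner (x + y) z = cinner x z + cinner y z"
    and cinner_scaleC_left: "cinner (c *\<^sub>C x) y = c * cinner x y"
    and Re_cinner: "Re (cinner x y) = inner x y"

instance complex_hilbert \<subseteq> banach ..

lemma scaleC_one [simp]: "1 *\<^sub>C x = (x :: 'a :: complex_normed_vector)"
  using scaleR_scaleC[of 1 x] by simp

lemma scaleC_bounded_bilinear: "bounded_bilinear (scaleC :: complex \<Rightarrow> 'a \<Rightarrow> 'a :: complex_normed_vector)"
proof (rule bounded_bilinear.intro)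
  fix r :: real and c :: complex and x :: 'a
  show "(r *\<^sub>R c) *\<^sub>C x = r *\<^sub>R (c *\<^sub>C x)"
    by (simp add: scaleR_scaleC scaleC_scaleC scaleR_conv_of_real)
  show "c *\<^sub>C (r *\<^sub>R x) = r *\<^sub>R (c *\<^sub>C x)"
    by (simp add: scaleR_scaleC scaleC_scaleC mult.commute)
  show "\<exists>K. \<forall>(a::complex) (b::'a). norm (a *\<^sub>C b) \<le> norm a * norm b * K"
    by (rule exI[of _ 1]) (simp add: norm_scaleC)
qed (simp_all add: scaleC_add_right scaleC_add_left)

interpretation scaleC: bounded_bilinear "scaleC :: complex \<Rightarrow> 'a \<Rightarrow> 'a :: complex_normed_vector"
  by (rule scaleC_bounded_bilinear)

lemma cinner_Cauchy_Schwarz: "cmod (cinner x y) \<le> norm x * norm (y :: 'a :: complex_hilbert)"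
proof (cases "cinner x y = 0")
  case False
  define c where "c = cnj (cinner x y) / complex_of_real (cmod (cinner x y))"
  have c: "cmod c = 1" using False by (simp add: c_def norm_divide)
  have "c * cinner x y = complex_of_real (cmod (cinner x y))"
    using False complex_norm_square[of "cinner x y"]
    by (simp add: c_def field_simps power2_eq_square)
  then have "cmod (cinner x y) = inner (c *\<^sub>C x) y"
    by (simp add: Re_cinner[symmetric] cinner_scaleC_left)
  also have "\<dots> \<le> norm (c *\<^sub>C x) * norm y" by (rule norm_cauchy_schwarz)
  finally show ?thesis by (simp add: norm_scaleC c)
qed simp

instantiation complex :: complex_hilbert
begin

definition scaleC_complex :: "complex \<Rightarrow> complex \<Rightarrow> complex"
  where "scaleC_complex c x = c * x"

definition cinner_complex :: "complex \<Rightarrow> complex \<Rightarrow> complex"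
  where "cinner_complex x y = x * cnj y"

instance
  by standard (simp_all add: scaleC_complex_def cinner_complex_def inner_complex_def
      algebra_simps norm_mult scaleR_conv_of_real)

end


section \<open>Operators\<close>

instantiation blinfun :: (real_normed_vector, complex_normed_vector) complex_normed_vector
begin

lift_definition scaleC_blinfun :: "complex \<Rightarrow> ('a \<Rightarrow>\<^sub>L 'b) \<Rightarrow> ('a \<Rightarrow>\<^sub>L 'b)"
  is "\<lambda>c f x. c *\<^sub>C f x"
  by (rule bounded_linear_compose[OF scaleC.bounded_linear_right])

instance
proof
  fix c d :: complex and r :: real and f g :: "'a \<Rightarrow>\<^sub>L 'b"
  show "c *\<^sub>C (f + g) = c *\<^sub>C f + c *\<^sub>C g" by transfer (simp add: scaleC_add_right)
  show "(c + d) *\<^sub>C f = c *\<^sub>C f + d *\<^sub>C f" by transfer (simp add: scaleC_add_left)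
  show assoc: "c *\<^sub>C d *\<^sub>C f = (c * d) *\<^sub>C f" for c d and f :: "'a \<Rightarrow>\<^sub>L 'b"
    by transfer (simp add: scaleC_scaleC)
  show "r *\<^sub>R f = complex_of_real r *\<^sub>C f" by transfer (simp add: scaleR_scaleC)
  have le: "norm (c *\<^sub>C f) \<le> cmod c * norm f" for c and f :: "'a \<Rightarrow>\<^sub>L 'b"
  proof (rule norm_blinfun_bound)
    fix x
    show "norm (blinfun_apply (c *\<^sub>C f) x) \<le> cmod c * norm f * norm x"
      using mult_left_mono[OF norm_blinfun[of f x], of "cmod c"]
      by (simp add: scaleC_blinfun.rep_eq norm_scaleC mult.assoc)
  qed simp
  show "norm (c *\<^sub>C f) = cmod c * norm f"
  proof (cases "c = 0")
    case True
    then show ?thesis using le[of c f] by simp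
  next
    case False
    have one: "1 *\<^sub>C f = f" by transfer simp
    have "norm f = norm (inverse c *\<^sub>C c *\<^sub>C f)" using False by (simp add: assoc one)
    also have "\<dots> \<le> inverse (cmod c) * norm (c *\<^sub>C f)"
      using le[of "inverse c" "c *\<^sub>C f"] by (simp add: norm_inverse)
    finally have "cmod c * norm f \<le> norm (c *\<^sub>C f)"
      using False by (simp add: field_simps)
    with le[of c f] show ?thesis by simp
  qed
qed

end

text \<open>The library type \<open>'a \<Rightarrow>\<^sub>L 'b\<close> consists of the bounded \<^emph>\<open>real\<close>-linear maps; the
  operators between complex spaces are its complex-linear elements.\<close>

definition operators :: "('a :: complex_normed_vector \<Rightarrow>\<^sub>L 'b :: complex_normed_vector) set"
  where "operators = {C. \<forall>c x. blinfun_apply C (c *\<^sub>C x) = c *\<^sub>C blinfun_apply C x}"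

definition contractions :: "('a :: complex_normed_vector \<Rightarrow>\<^sub>L 'b :: complex_normed_vector) set"
  where "contractions = {C \<in> operators. norm C \<le> 1}"

text \<open>Operators between linear subspaces \<open>S\<close> and \<open>T\<close>; only the values on \<open>S\<close> matter.\<close>

definition operators_between ::
    "'a :: complex_normed_vector set \<Rightarrow> 'b :: complex_normed_vector set \<Rightarrow> ('a \<Rightarrow> 'b) set"
  where "operators_between S T = {X.
    X ` S \<subseteq> T \<and>
    (\<forall>x\<in>S. \<forall>y\<in>S. X (x + y) = X x + X y) \<and>
    (\<forall>c. \<forall>x\<in>S. X (c *\<^sub>C x) = c *\<^sub>C X x) \<and>
    (\<exists>K. \<forall>x\<in>S. norm (X x) \<le> K * norm x)}"

definition hilbert_adjoint ::
    "('a :: complex_hilbert \<Rightarrow>\<^sub>L 'b :: complex_hilbert) \<Rightarrow> ('b \<Rightarrow>\<^sub>L 'a)"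
  where "hilbert_adjoint C = (THE A. A \<in> operators \<and>
    (\<forall>x y. cinner (blinfun_apply C x) y = cinner x (blinfun_apply A y)))"

definition positive_operator :: "('a :: complex_hilbert \<Rightarrow>\<^sub>L 'a) \<Rightarrow> bool"
  where "positive_operator R \<longleftrightarrow> R \<in> operators \<and>
    (\<forall>x. cinner (blinfun_apply R x) x \<in> nonneg_Reals)"

definition operator_sqrt :: "('a :: complex_hilbert \<Rightarrow>\<^sub>L 'a) \<Rightarrow> ('a \<Rightarrow>\<^sub>L 'a)"
  where "operator_sqrt P = (THE R. positive_operator R \<and> R o\<^sub>L R = P)"

definition defect_operator ::
    "('a :: complex_hilbert \<Rightarrow>\<^sub>L 'b :: complex_hilbert) \<Rightarrow> ('a \<Rightarrow>\<^sub>L 'a)"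
  where "defect_operator C = operator_sqrt (id_blinfun - (hilbert_adjoint C o\<^sub>L C))"

definition defect_space :: "('a :: complex_hilbert \<Rightarrow>\<^sub>L 'b :: complex_hilbert) \<Rightarrow> 'a set"
  where "defect_space C = closure (range (blinfun_apply (defect_operator C)))"

definition defect_prec ::
    "('a :: complex_hilbert \<Rightarrow>\<^sub>L 'b :: complex_hilbert) \<Rightarrow> ('a \<Rightarrow>\<^sub>L 'b) \<Rightarrow> bool" (infix \<open>\<prec>\<^sub>D\<close> 50)
  where "A \<prec>\<^sub>D B \<longleftrightarrow>
    (\<exists>X \<in> operators_between (defect_space B) (defect_space (hilbert_adjoint B)).
      \<forall>x. blinfun_apply (A - B) x =
        blinfun_apply (defect_operator (hilbert_adjoint B)) (X (blinfun_apply (defect_operator B) x)))"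


section \<open>The Schur class\<close>

abbreviation unit_disc :: "complex set" (\<open>\<D>\<close>)
  where "\<D> \<equiv> ball 0 1"

text \<open>Complex differentiability in norm; for operator-valued functions the norm is the
  operator norm.\<close>

definition vector_holomorphic_on :: "(complex \<Rightarrow> 'a :: complex_normed_vector) \<Rightarrow> complex set \<Rightarrow> bool"
  where "vector_holomorphic_on f S \<longleftrightarrow>
    (\<forall>z\<in>S. \<exists>f'. (f has_derivative (\<lambda>h. h *\<^sub>C f')) (at z within S))"

definition Schur_class ::
    "(complex \<Rightarrow> 'a :: complex_hilbert \<Rightarrow>\<^sub>L 'b :: complex_hilbert) set"
  where "Schur_class = {F. vector_holomorphic_on F \<D> \<and> (\<forall>z\<in>\<D>. F z \<in> contractions)}"


section \<open>The vector-valued Hardy space on the disc\<close>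

definition taylor_on_disc :: "(complex \<Rightarrow> 'a :: complex_normed_vector) \<Rightarrow> (nat \<Rightarrow> 'a) \<Rightarrow> bool"
  where "taylor_on_disc f a \<longleftrightarrow> (\<forall>z\<in>\<D>. (\<lambda>n. z ^ n *\<^sub>C a n) sums f z)"

definition square_summable :: "(nat \<Rightarrow> 'a :: real_normed_vector) \<Rightarrow> bool"
  where "square_summable a \<longleftrightarrow> summable (\<lambda>n. (norm (a n))\<^sup>2)"

text \<open>A function on the disc is represented by its extension by \<open>0\<close>, so that equality in the
  type is equality on the disc.\<close>

typedef (overloaded) 'a hardy =
    "{f :: complex \<Rightarrow> 'a :: complex_hilbert.
       (\<exists>a. square_summable a \<and> taylor_on_disc f a) \<and> (\<forall>z. z \<notin> \<D> \<longrightarrow> f z = 0)}"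
  morphisms hardy_apply Abs_hardy
  by (rule exI[of _ "\<lambda>_. 0"])
    (auto simp: square_summable_def taylor_on_disc_def scaleC.zero_right intro!: exI[of _ "\<lambda>_. 0"])

setup_lifting type_definition_hardy

definition hardy_coeff :: "'a :: complex_hilbert hardy \<Rightarrow> nat \<Rightarrow> 'a"
  where "hardy_coeff f = (THE a. taylor_on_disc (hardy_apply f) a)"

lemma taylor_on_disc_add:
  assumes "taylor_on_disc f a" "taylor_on_disc g b"
  shows "taylor_on_disc (\<lambda>z. f z + g z) (\<lambda>n. a n + b n)"
  using assms by (auto simp: taylor_on_disc_def scaleC.add_right intro: sums_add)

lemma taylor_on_disc_diff:
  assumes "taylor_on_disc f a" "taylor_on_disc g b"
  shows "taylor_on_disc (\<lambda>z. f z - g z) (\<lambda>n. a n - b n)"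
  using assms by (auto simp: taylor_on_disc_def scaleC.diff_right intro: sums_diff)

lemma taylor_on_disc_scaleC:
  assumes "taylor_on_disc f a"
  shows "taylor_on_disc (\<lambda>z. c *\<^sub>C f z) (\<lambda>n. c *\<^sub>C a n)"
  unfolding taylor_on_disc_def
proof
  fix z assume "z \<in> \<D>"
  then show "(\<lambda>n. z ^ n *\<^sub>C c *\<^sub>C a n) sums (c *\<^sub>C f z)"
    using bounded_linear.sums[OF scaleC.bounded_linear_right[of c], of "\<lambda>n. z ^ n *\<^sub>C a n" "f z"] assms
    by (auto simp: taylor_on_disc_def scaleC_scaleC mult.commute)
qed

lemma taylor_on_disc_zero:
  fixes a :: "nat \<Rightarrow> 'a :: complex_hilbert"
  assumes "taylor_on_disc (\<lambda>_. 0) a"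
  shows "a n = 0"
proof -
  have "inner (a n) y = 0" for y
  proof (rule ccontr)
    assume nz: "inner (a n) y \<noteq> 0"
    have s: "(\<lambda>n. inner (a n) y * x ^ n) sums 0" if "norm x < 1" for x :: real
    proof -
      have "(\<lambda>n. complex_of_real x ^ n *\<^sub>C a n) sums 0"
        using assms that by (auto simp: taylor_on_disc_def)
      from bounded_linear.sums[OF bounded_linear_inner_left[of y] this]
      show ?thesis
        by (simp add: of_real_power[symmetric] scaleR_scaleC[symmetric] mult.commute del: of_real_power)
    qed
    define N where "N = (LEAST n. inner (a n) y \<noteq> 0)"
    have N: "inner (a N) y \<noteq> 0" unfolding N_def using nz by (rule LeastI)
    have below: "inner (a k) y = 0" if "k < N" for k
      using that not_less_Least unfolding N_def by blast
    have sh: "(\<lambda>n. inner (a (n + N)) y * x ^ n) sums 0" if "x \<noteq> 0" "norm x < 1" for x :: real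
    proof -
      have "(\<lambda>n. inner (a (n + N)) y * x ^ (n + N)) sums 0"
        using sums_split_initial_segment[OF s[OF that(2)], of N] below by simp
      from sums_mult2[OF this, of "inverse (x ^ N)"] show ?thesis
        using that by (simp add: power_add field_simps)
    qed
    have "((\<lambda>x::real. 0::real) \<longlongrightarrow> inner (a (0 + N)) y) (at 0)"
      by (rule powser_limit_0_strong[of 1 "\<lambda>n. inner (a (n + N)) y"]) (use sh in auto)
    then have "inner (a N) y = 0" using LIM_const_eq[of 0] by fastforce
    with N show False by simp
  qed
  then show ?thesis using inner_eq_zero_iff by blast
qed

lemma taylor_on_disc_unique:
  fixes a :: "nat \<Rightarrow> 'a :: complex_hilbert"
  assumes "taylor_on_disc f a" "taylor_on_disc f b"
  shows "a = b"
proof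
  fix n
  show "a n = b n"
    using taylor_on_disc_zero[of "\<lambda>n. a n - b n" n] taylor_on_disc_diff[OF assms] by simp
qed

lemma taylor_on_disc_fun_unique:
  assumes "taylor_on_disc f a" "taylor_on_disc g a" "z \<in> \<D>"
  shows "f z = g z"
  using assms unfolding taylor_on_disc_def by (metis sums_unique2)

lemma square_summable_add:
  assumes "square_summable a" "square_summable b"
  shows "square_summable (\<lambda>n. a n + b n)"
  unfolding square_summable_def
proof (rule summable_comparison_test')
  show "summable (\<lambda>n. 2 * (norm (a n))\<^sup>2 + 2 * (norm (b n))\<^sup>2)"
    using assms unfolding square_summable_def by (intro summable_add summable_mult)
  fix n
  have "(norm (a n + b n))\<^sup>2 \<le> (norm (a n) + norm (b n))\<^sup>2"
    by (intro power_mono norm_triangle_ineq) auto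
  also have "\<dots> \<le> 2 * (norm (a n))\<^sup>2 + 2 * (norm (b n))\<^sup>2"
    using sum_squares_bound[of "norm (a n)" "norm (b n)"] by (simp add: power2_sum)
  finally show "norm ((norm (a n + b n))\<^sup>2) \<le> 2 * (norm (a n))\<^sup>2 + 2 * (norm (b n))\<^sup>2" by simp
qed

lemma square_summable_scaleC:
  "square_summable a \<Longrightarrow> square_summable (\<lambda>n. c *\<^sub>C (a n :: 'a :: complex_normed_vector))"
  by (simp add: square_summable_def norm_scaleC power_mult_distrib summable_mult)

lemma square_summable_uminus: "square_summable a \<Longrightarrow> square_summable (\<lambda>n. - a n)"
  by (simp add: square_summable_def)

lemma square_summable_diff:
  "square_summable a \<Longrightarrow> square_summable b \<Longrightarrow> square_summable (\<lambda>n. a n - b n)"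
  using square_summable_add[of a "\<lambda>n. - b n"] square_summable_uminus[of b] by simp

lemma square_summable_zero: "square_summable (\<lambda>_. 0)"
  by (simp add: square_summable_def)

lemma square_summable_cinner:
  assumes "square_summable a" "square_summable b"
  shows "summable (\<lambda>n. cinner (a n) (b n :: 'a :: complex_hilbert))"
proof (rule summable_comparison_test')
  show "summable (\<lambda>n. (norm (a n))\<^sup>2 + (norm (b n))\<^sup>2)"
    using assms unfolding square_summable_def by (intro summable_add)
  fix n
  have "cmod (cinner (a n) (b n)) \<le> norm (a n) * norm (b n)" by (rule cinner_Cauchy_Schwarz)
  also have "\<dots> \<le> (norm (a n))\<^sup>2 + (norm (b n))\<^sup>2"
    using sum_squares_bound[of "norm (a n)" "norm (b n)"]
      mult_nonneg_nonneg[OF norm_ge_zero[of "a n"] norm_ge_zero[of "b n"]] by linarith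
  finally show "norm (cinner (a n) (b n)) \<le> (norm (a n))\<^sup>2 + (norm (b n))\<^sup>2" .
qed

lemma square_summable_powser:
  fixes a :: "nat \<Rightarrow> 'a :: complex_hilbert"
  assumes a: "square_summable a" and z: "z \<in> \<D>"
  shows "summable (\<lambda>n. z ^ n *\<^sub>C a n)"
proof (rule summable_comparison_test')
  have "cmod z ^ 2 < 1" using z by (simp add: power_less_one_iff abs_square_less_1)
  then have "summable (\<lambda>n. (cmod z ^ 2) ^ n)" by (simp add: summable_geometric)
  then show "summable (\<lambda>n. (cmod z ^ 2) ^ n + (norm (a n))\<^sup>2)"
    using a unfolding square_summable_def by (intro summable_add)
  fix n
  have "norm (z ^ n *\<^sub>C a n) = cmod z ^ n * norm (a n)" by (simp add: norm_scaleC norm_power)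
  also have "\<dots> \<le> (cmod z ^ n)\<^sup>2 + (norm (a n))\<^sup>2"
    using sum_squares_bound[of "cmod z ^ n" "norm (a n)"]
      mult_nonneg_nonneg[OF zero_le_power[OF norm_ge_zero[of z], of n] norm_ge_zero[of "a n"]]
    by linarith
  finally show "norm (z ^ n *\<^sub>C a n) \<le> (cmod z ^ 2) ^ n + (norm (a n))\<^sup>2"
    by (simp add: power_mult[symmetric] mult.commute)
qed

lemma hardy_coeff_eqI: "taylor_on_disc (hardy_apply f) a \<Longrightarrow> hardy_coeff f = a"
  unfolding hardy_coeff_def by (rule the_equality) (auto intro: taylor_on_disc_unique)

lemma hardy_coeff:
  shows taylor_hardy_coeff: "taylor_on_disc (hardy_apply f) (hardy_coeff f)"
    and square_summable_hardy_coeff: "square_summable (hardy_coeff f)"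
proof -
  obtain a where "square_summable a" "taylor_on_disc (hardy_apply f) a"
    using hardy_apply[of f] by auto
  then show "taylor_on_disc (hardy_apply f) (hardy_coeff f)" "square_summable (hardy_coeff f)"
    using hardy_coeff_eqI by metis+
qed

lemma hardy_coeff_inject: "hardy_coeff f = hardy_coeff g \<Longrightarrow> f = g"
proof -
  assume eq: "hardy_coeff f = hardy_coeff g"
  have "hardy_apply f z = hardy_apply g z" for z
  proof (cases "z \<in> \<D>")
    case True
    then show ?thesis
      using taylor_on_disc_fun_unique taylor_hardy_coeff[of f] taylor_hardy_coeff[of g] eq by metis
  next
    case False
    then show ?thesis using hardy_apply[of f] hardy_apply[of g] by simp
  qed
  then show "f = g" by (simp add: hardy_apply_inject[symmetric] fun_eq_iff)
qed

lemma hardy_coeff_surj: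
  fixes a :: "nat \<Rightarrow> 'a :: complex_hilbert"
  assumes "square_summable a"
  obtains f where "hardy_coeff f = a"
proof
  let ?f = "\<lambda>z. if z \<in> \<D> then \<Sum>n. z ^ n *\<^sub>C a n else 0"
  have t: "taylor_on_disc ?f a"
    using square_summable_powser[OF assms] by (auto simp: taylor_on_disc_def summable_sums)
  then have "hardy_apply (Abs_hardy ?f) = ?f"
    using assms by (intro Abs_hardy_inverse) auto
  then show "hardy_coeff (Abs_hardy ?f) = a"
    using t by (intro hardy_coeff_eqI) metis
qed

lemma summable_cinner_hardy:
  "summable (\<lambda>n. cinner (hardy_coeff f n) (hardy_coeff (g :: 'a :: complex_hilbert hardy) n))"
  by (rule square_summable_cinner) (rule square_summable_hardy_coeff)+

instantiation hardy :: (complex_hilbert) real_inner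
begin

lift_definition zero_hardy :: "'a hardy" is "\<lambda>_. 0"
  by (auto simp: taylor_on_disc_def scaleC.zero_right intro!: exI[of _ "\<lambda>_. 0"] square_summable_zero)

lift_definition plus_hardy :: "'a hardy \<Rightarrow> 'a hardy \<Rightarrow> 'a hardy" is "\<lambda>f g z. f z + g z"
proof (elim CollectE conjE exE, intro CollectI conjI)
  fix f g :: "complex \<Rightarrow> 'a" and a b
  assume "square_summable a" "taylor_on_disc f a" "square_summable b" "taylor_on_disc g b"
  then show "\<exists>a. square_summable a \<and> taylor_on_disc (\<lambda>z. f z + g z) a"
    by (intro exI[of _ "\<lambda>n. a n + b n"] conjI square_summable_add taylor_on_disc_add)
qed simp

lift_definition minus_hardy :: "'a hardy \<Rightarrow> 'a hardy \<Rightarrow> 'a hardy" is "\<lambda>f g z. f z - g z"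
proof (elim CollectE conjE exE, intro CollectI conjI)
  fix f g :: "complex \<Rightarrow> 'a" and a b
  assume "square_summable a" "taylor_on_disc f a" "square_summable b" "taylor_on_disc g b"
  then show "\<exists>a. square_summable a \<and> taylor_on_disc (\<lambda>z. f z - g z) a"
    by (intro exI[of _ "\<lambda>n. a n - b n"] conjI square_summable_diff taylor_on_disc_diff)
qed simp

lift_definition scaleR_hardy :: "real \<Rightarrow> 'a hardy \<Rightarrow> 'a hardy" is "\<lambda>r f z. r *\<^sub>R f z"
proof (elim CollectE conjE exE, intro CollectI conjI)
  fix f :: "complex \<Rightarrow> 'a" and a and r :: real
  assume "square_summable a" "taylor_on_disc f a"
  then show "\<exists>a. square_summable a \<and> taylor_on_disc (\<lambda>z. r *\<^sub>R f z) a"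
    unfolding scaleR_scaleC
    by (intro exI[of _ "\<lambda>n. complex_of_real r *\<^sub>C a n"] conjI square_summable_scaleC taylor_on_disc_scaleC)
qed simp

definition uminus_hardy :: "'a hardy \<Rightarrow> 'a hardy"
  where "uminus_hardy f = 0 - f"

definition inner_hardy :: "'a hardy \<Rightarrow> 'a hardy \<Rightarrow> real"
  where "inner_hardy f g = (\<Sum>n. inner (hardy_coeff f n) (hardy_coeff g n))"

definition norm_hardy :: "'a hardy \<Rightarrow> real"
  where "norm_hardy f = sqrt (inner f f)"

definition sgn_hardy :: "'a hardy \<Rightarrow> 'a hardy"
  where "sgn_hardy f = inverse (norm f) *\<^sub>R f"

definition dist_hardy :: "'a hardy \<Rightarrow> 'a hardy \<Rightarrow> real"
  where "dist_hardy f g = norm (f - g)"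

definition uniformity_hardy :: "('a hardy \<times> 'a hardy) filter"
  where "uniformity_hardy = (INF e\<in>{0 <..}. principal {(x, y). dist x y < e})"

definition open_hardy :: "'a hardy set \<Rightarrow> bool"
  where "open_hardy S = (\<forall>x\<in>S. \<forall>\<^sub>F (x', y) in uniformity. x' = x \<longrightarrow> y \<in> S)"

lemma hardy_coeff_zero: "hardy_coeff (0 :: 'a hardy) = (\<lambda>_. 0)"
  by (rule hardy_coeff_eqI) (simp add: zero_hardy.rep_eq taylor_on_disc_def scaleC.zero_right)

lemma hardy_coeff_plus: "hardy_coeff (f + g :: 'a hardy) = (\<lambda>n. hardy_coeff f n + hardy_coeff g n)"
  by (rule hardy_coeff_eqI)
    (simp add: plus_hardy.rep_eq taylor_on_disc_add[OF taylor_hardy_coeff taylor_hardy_coeff])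

lemma hardy_coeff_minus: "hardy_coeff (f - g :: 'a hardy) = (\<lambda>n. hardy_coeff f n - hardy_coeff g n)"
  by (rule hardy_coeff_eqI)
    (simp add: minus_hardy.rep_eq taylor_on_disc_diff[OF taylor_hardy_coeff taylor_hardy_coeff])

lemma hardy_coeff_scaleR: "hardy_coeff (r *\<^sub>R f :: 'a hardy) = (\<lambda>n. r *\<^sub>R hardy_coeff f n)"
  by (rule hardy_coeff_eqI)
    (use taylor_on_disc_scaleC[OF taylor_hardy_coeff, of "complex_of_real r" f] in
      \<open>simp add: scaleR_hardy.rep_eq scaleR_scaleC\<close>)

lemma summable_inner_hardy:
  "summable (\<lambda>n. inner (hardy_coeff f n) (hardy_coeff (g :: 'a hardy) n))"
  unfolding Re_cinner[symmetric]
  by (intro summable_Re summable_cinner_hardy)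

lemma inner_self_hardy: "inner f (f :: 'a hardy) = (\<Sum>n. (norm (hardy_coeff f n))\<^sup>2)"
  by (simp add: inner_hardy_def dot_square_norm)

instance
proof
  fix f g h :: "'a hardy" and r s :: real
  show "f + g + h = f + (g + h)" by transfer (simp add: add.assoc)
  show "f + g = g + f" by transfer (simp add: add.commute)
  show "0 + f = f" by transfer simp
  show "- f + f = 0" unfolding uminus_hardy_def by transfer simp
  show "f - g = f + - g" unfolding uminus_hardy_def by transfer simp
  show "r *\<^sub>R (f + g) = r *\<^sub>R f + r *\<^sub>R g" by transfer (simp add: scaleR_add_right)
  show "(r + s) *\<^sub>R f = r *\<^sub>R f + s *\<^sub>R f" by transfer (simp add: scaleR_add_left)
  show "r *\<^sub>R s *\<^sub>R f = (r * s) *\<^sub>R f" by transfer simp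
  show "1 *\<^sub>R f = f" by transfer simp
  show "dist f g = norm (f - g)" by (rule dist_hardy_def)
  show "sgn f = inverse (norm f) *\<^sub>R f" by (rule sgn_hardy_def)
  show "uniformity = (INF e\<in>{0 <..}. principal {(x, y :: 'a hardy). dist x y < e})"
    by (rule uniformity_hardy_def)
  show "open U = (\<forall>x\<in>U. \<forall>\<^sub>F (x', y) in uniformity. x' = x \<longrightarrow> y \<in> U)" for U :: "'a hardy set"
    by (rule open_hardy_def)
  show "inner f g = inner g f" by (simp add: inner_hardy_def inner_commute)
  show "inner (f + g) h = inner f h + inner g h"
    unfolding inner_hardy_def hardy_coeff_plus inner_add_left
    by (rule suminf_add[symmetric]) (rule summable_inner_hardy)+
  show "inner (r *\<^sub>R f) g = r * inner f g"
    unfolding inner_hardy_def hardy_coeff_scaleR inner_scaleR_left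
    by (rule suminf_mult) (rule summable_inner_hardy)
  have sm: "summable (\<lambda>n. (norm (hardy_coeff f n))\<^sup>2)"
    using square_summable_hardy_coeff[of f] by (simp add: square_summable_def)
  show "0 \<le> inner f f"
    unfolding inner_self_hardy by (rule suminf_nonneg[OF sm]) simp
  show "(inner f f = 0) = (f = 0)"
  proof
    assume "inner f f = 0"
    then have "\<forall>n. (norm (hardy_coeff f n))\<^sup>2 = 0"
      unfolding inner_self_hardy using suminf_eq_zero_iff[OF sm] by simp
    then show "f = 0"
      by (intro hardy_coeff_inject) (auto simp: hardy_coeff_zero)
  next
    assume "f = 0"
    then show "inner f f = 0" by (simp add: inner_self_hardy hardy_coeff_zero)
  qed
  show "norm f = sqrt (inner f f)" by (rule norm_hardy_def)
qed

end

lemma norm_hardy_sq: "(norm (f :: 'a :: complex_hilbert hardy))\<^sup>2 = (\<Sum>n. (norm (hardy_coeff f n))\<^sup>2)"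
  by (simp add: power2_norm_eq_inner inner_self_hardy)

lemma hardy_partial_sum_le: "(\<Sum>n<M. (norm (hardy_coeff f n))\<^sup>2) \<le> (norm (f :: 'a :: complex_hilbert hardy))\<^sup>2"
  unfolding norm_hardy_sq
  by (rule sum_le_suminf)
    (use square_summable_hardy_coeff[of f] in \<open>auto simp: square_summable_def\<close>)

instance hardy :: (complex_hilbert) complete_space
proof
  fix X :: "nat \<Rightarrow> 'a hardy"
  assume "Cauchy X"
  then have X: "\<exists>N. \<forall>k\<ge>N. \<forall>l\<ge>N. norm (X k - X l) < e" if "e > 0" for e
    using that by (auto simp: Cauchy_def dist_norm)
  let ?c = "\<lambda>k. hardy_coeff (X k)"
  have single: "norm (hardy_coeff f n) \<le> norm f" for f :: "'a hardy" and n
  proof -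
    have "(norm (hardy_coeff f n))\<^sup>2 \<le> (\<Sum>i<Suc n. (norm (hardy_coeff f i))\<^sup>2)"
      by (simp add: sum_nonneg)
    also have "\<dots> \<le> (norm f)\<^sup>2" by (rule hardy_partial_sum_le)
    finally show ?thesis
      by (rule power2_le_imp_le) simp
  qed
  have "Cauchy (\<lambda>k. ?c k n)" for n
  proof (rule CauchyI)
    fix e :: real assume "e > 0"
    then obtain N where "\<forall>k\<ge>N. \<forall>l\<ge>N. norm (X k - X l) < e" using X by blast
    then show "\<exists>N. \<forall>k\<ge>N. \<forall>l\<ge>N. norm (?c k n - ?c l n) < e"
      using single[of "X k - X l" n for k l] unfolding hardy_coeff_minus
      by (meson le_less_trans)
  qed
  then have "\<forall>n. \<exists>a. (\<lambda>k. ?c k n) \<longlonglongrightarrow> a"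
    using Cauchy_convergent convergent_def by blast
  then obtain a where a: "\<And>n. (\<lambda>k. ?c k n) \<longlonglongrightarrow> a n" by metis
  have key: "\<exists>N. \<forall>k\<ge>N. \<forall>M. (\<Sum>n<M. (norm (?c k n - a n))\<^sup>2) \<le> e\<^sup>2" if e: "e > 0" for e :: real
  proof -
    obtain N where N: "\<forall>k\<ge>N. \<forall>l\<ge>N. norm (X k - X l) < e" using X[OF e] by blast
    show ?thesis
    proof (intro exI[of _ N] allI impI)
      fix k M assume k: "N \<le> k"
      have lim: "(\<lambda>l. \<Sum>n<M. (norm (?c k n - ?c l n))\<^sup>2) \<longlonglongrightarrow> (\<Sum>n<M. (norm (?c k n - a n))\<^sup>2)"
        by (intro tendsto_intros a)
      have "(\<Sum>n<M. (norm (?c k n - ?c l n))\<^sup>2) \<le> e\<^sup>2" if l: "l \<ge> N" for l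
      proof -
        have "(\<Sum>n<M. (norm (?c k n - ?c l n))\<^sup>2) \<le> (norm (X k - X l))\<^sup>2"
          using hardy_partial_sum_le[where f = "X k - X l" and M = M] by (simp add: hardy_coeff_minus)
        also have "\<dots> \<le> e\<^sup>2"
          using N k l by (intro power_mono) (auto simp: less_imp_le)
        finally show ?thesis .
      qed
      then show "(\<Sum>n<M. (norm (?c k n - a n))\<^sup>2) \<le> e\<^sup>2"
        by (intro LIMSEQ_le_const2[OF lim]) blast
    qed
  qed
  have tail: "square_summable (\<lambda>n. ?c k n - a n)"
    if "\<forall>M. (\<Sum>n<M. (norm (?c k n - a n))\<^sup>2) \<le> e\<^sup>2" for k and e :: real
    unfolding square_summable_def
    by (rule bounded_imp_summable[of _ "e\<^sup>2"]) (use that in \<open>auto simp: lessThan_Suc_atMost[symmetric] simp del: sum.lessThan_Suc\<close>)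
  obtain N where "\<forall>k\<ge>N. \<forall>M. (\<Sum>n<M. (norm (?c k n - a n))\<^sup>2) \<le> 1\<^sup>2" using key[of 1] by auto
  then have "square_summable (\<lambda>n. ?c N n - a n)" using tail by blast
  from square_summable_diff[OF square_summable_hardy_coeff[of "X N"] this]
  have "square_summable a" by simp
  then obtain L where L: "hardy_coeff L = a" by (rule hardy_coeff_surj)
  show "convergent X"
  proof (rule convergentI, rule LIMSEQ_I)
    fix e :: real assume e: "e > 0"
    then obtain N where N: "\<forall>k\<ge>N. \<forall>M. (\<Sum>n<M. (norm (?c k n - a n))\<^sup>2) \<le> (e / 2)\<^sup>2"
      using key[of "e / 2"] by auto
    show "\<exists>N. \<forall>k\<ge>N. norm (X k - L) < e"
    proof (intro exI[of _ N] allI impI)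
      fix k assume k: "N \<le> k"
      have "(norm (X k - L))\<^sup>2 \<le> (e / 2)\<^sup>2"
        unfolding norm_hardy_sq hardy_coeff_minus L
        using N k tail[of k "e / 2"] by (intro suminf_le_const) (auto simp: square_summable_def)
      then have "norm (X k - L) \<le> e / 2"
        by (rule power2_le_imp_le) (use e in auto)
      then show "norm (X k - L) < e" using e by simp
    qed
  qed
qed

instantiation hardy :: (complex_hilbert) complex_hilbert
begin

lift_definition scaleC_hardy :: "complex \<Rightarrow> 'a hardy \<Rightarrow> 'a hardy" is "\<lambda>c f z. c *\<^sub>C f z"
proof (elim CollectE conjE exE, intro CollectI conjI)
  fix f :: "complex \<Rightarrow> 'a" and a c
  assume "square_summable a" "taylor_on_disc f a"
  then show "\<exists>a. square_summable a \<and> taylor_on_disc (\<lambda>z. c *\<^sub>C f z) a"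
    by (intro exI[of _ "\<lambda>n. c *\<^sub>C a n"] conjI square_summable_scaleC taylor_on_disc_scaleC)
qed (simp add: scaleC.zero_right)

definition cinner_hardy :: "'a hardy \<Rightarrow> 'a hardy \<Rightarrow> complex"
  where "cinner_hardy f g = (\<Sum>n. cinner (hardy_coeff f n) (hardy_coeff g n))"

lemma hardy_coeff_scaleC: "hardy_coeff (c *\<^sub>C f :: 'a hardy) = (\<lambda>n. c *\<^sub>C hardy_coeff f n)"
  by (rule hardy_coeff_eqI)
    (simp add: scaleC_hardy.rep_eq taylor_on_disc_scaleC[OF taylor_hardy_coeff])

instance
proof
  fix f g h :: "'a hardy" and r :: real and c d :: complex
  show "c *\<^sub>C (f + g) = c *\<^sub>C f + c *\<^sub>C g" by transfer (simp add: scaleC_add_right)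
  show "(c + d) *\<^sub>C f = c *\<^sub>C f + d *\<^sub>C f" by transfer (simp add: scaleC_add_left)
  show "c *\<^sub>C d *\<^sub>C f = (c * d) *\<^sub>C f" by transfer (simp add: scaleC_scaleC)
  show "r *\<^sub>R f = complex_of_real r *\<^sub>C f" by transfer (simp add: scaleR_scaleC)
  have "(norm (c *\<^sub>C f))\<^sup>2 = (cmod c * norm f)\<^sup>2"
    unfolding power_mult_distrib norm_hardy_sq hardy_coeff_scaleC norm_scaleC
    by (rule suminf_mult) (use square_summable_hardy_coeff[of f] in \<open>simp add: square_summable_def\<close>)
  then show "norm (c *\<^sub>C f) = cmod c * norm f"
    by (rule power2_eq_imp_eq) simp_all
  have "(\<lambda>n. cnj (cinner (hardy_coeff g n) (hardy_coeff f n))) sums cnj (cinner g f)"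
    unfolding cinner_hardy_def sums_cnj by (intro summable_sums summable_cinner_hardy)
  then show "cinner f g = cnj (cinner g f)"
    by (subst (1) cinner_hardy_def) (simp add: cinner_commute[symmetric] sums_iff)
  show "cinner (f + g) h = cinner f h + cinner g h"
    unfolding cinner_hardy_def hardy_coeff_plus cinner_add_left
    by (rule suminf_add[symmetric]) (rule summable_cinner_hardy)+
  show "cinner (c *\<^sub>C f) g = c * cinner f g"
    unfolding cinner_hardy_def hardy_coeff_scaleC cinner_scaleC_left
    by (rule suminf_mult) (rule summable_cinner_hardy)
  show "Re (cinner f g) = inner f g"
    unfolding cinner_hardy_def inner_hardy_def Re_cinner[symmetric]
    by (rule Re_suminf) (rule summable_cinner_hardy)
qed

end

text \<open>Multiplication by \<open>F\<close>; this operator between Hardy spaces exists and is a contraction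
  for \<open>F\<close> in the Schur class.\<close>

definition multiplication_operator ::
    "(complex \<Rightarrow> 'a :: complex_hilbert \<Rightarrow>\<^sub>L 'b :: complex_hilbert) \<Rightarrow> ('a hardy \<Rightarrow>\<^sub>L 'b hardy)"
  where "multiplication_operator F =
    (THE T. \<forall>h. \<forall>z\<in>\<D>. hardy_apply (blinfun_apply T h) z = blinfun_apply (F z) (hardy_apply h z))"

end

theory Submission
  imports Defs "HOL-Complex_Analysis.Cauchy_Integral_Formula"
begin

text \<open>
  For a contraction \<open>B\<close>, the relation \<open>A \<prec>\<^sub>D B\<close> is a bound on a form: it holds exactly if
  \<open>cmod (cinner ((A - B) x) y) \<le> r * norm (D x) * norm (D' y)\<close> for some \<open>r\<close> and all \<open>x\<close>, \<open>y\<close>, where \<open>D\<close> and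
  \<open>D'\<close> are the defect operators of \<open>B\<close> and of its adjoint (\<open>defect_prec_iff_dominated\<close>). With the same \<open>r\<close>,
  the bound is equivalent to a factorisation \<open>A - B = D' Q D\<close> with \<open>norm Q \<le> r\<close>. Since
  \<open>(norm (D x))\<^sup>2 = (norm x)\<^sup>2 - (norm (B x))\<^sup>2\<close>, only the squares of the defect operators matter. The theorem
  says that this bound holds for the multiplication operators with some \<open>r\<close> if and only if it holds
  at all points of the disc with one \<open>r\<close>; in fact the same \<open>r\<close> serves on both sides.

  From operators to points, the bound is tested on Szego kernels at \<open>w\<close> with values \<open>u\<close> and \<open>y\<close>. Up to the
  factor \<open>1 / (1 - (cmod w)\<^sup>2)\<close>, which both sides have in common, the left side becomes the form of \<open>F w - G w\<close> at \<open>u\<close> and \<open>y\<close>, the defect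
  of the adjoint becomes the defect of the adjoint of \<open>G w\<close>, and the defect of the multiplication operator is
  at most that of \<open>G w\<close> (\<open>defect_dominated_at_point\<close>).

  From points to operators, one would integrate the pointwise bound over the unit circle. Boundary
  values of operator-valued functions are avoided as follows. By the inequality of arithmetic and
  geometric means twice the product of norms is replaced by \<open>t * (norm (D f))\<^sup>2 + (norm (D' g))\<^sup>2 / t\<close> for
  arbitrary \<open>t > 0\<close>, and the term \<open>- (norm (hilbert_adjoint (G z) (g z)))\<^sup>2\<close>, in which a nonanalytic function occurs,
  by the larger \<open>(norm (x z))\<^sup>2 - 2 * inner (G z (x z)) (g z)\<close> for an arbitrary function \<open>x\<close> in the Hardy space. Now the inequality
  only contains inner products of Hardy space functions; their means over the circles of
  radius \<open>\<rho> < 1\<close> tend to the inner products in the Hardy space as \<open>\<rho>\<close> tends to \<open>1\<close>. No loss occurs if \<open>x\<close> is the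
  image of \<open>g\<close> under the adjoint of the multiplication operator, and optimising \<open>t\<close> yields the bound
  (\<open>defect_dominated_multiplication\<close>).

  The preparations are adjoints and factorisations, which both come from a single Riesz-type
  representation theorem, existence and uniqueness of positive square roots, and Taylor series for
  weakly holomorphic functions, which show that multiplication by a Schur function maps
  the Hardy space contractively into the Hardy space.
\<close>

section \<open>The complex inner product and Riesz representation\<close>

lemma cinner_bounded_bilinear:
  "bounded_bilinear (cinner :: 'a :: complex_hilbert \<Rightarrow> 'a \<Rightarrow> complex)"
proof (rule bounded_bilinear.intro)
  fix r :: real and x y z :: 'a
  show right: "cinner x (y + z) = cinner x y + cinner x z"
    using cinner_add_left[of y z x] cinner_commute[of x "y + z"] cinner_commute[of x y]
      cinner_commute[of x z] by simp
  show "cinner (r *\<^sub>R x) y = r *\<^sub>R cinner x y"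
    by (simp add: scaleR_scaleC cinner_scaleC_left scaleC_complex_def)
  show "cinner x (r *\<^sub>R y) = r *\<^sub>R cinner x y"
    using cinner_scaleC_left[of "complex_of_real r" y x] cinner_commute[of x "r *\<^sub>R y"]
      cinner_commute[of x y] by (simp add: scaleR_scaleC scaleC_complex_def)
  show "\<exists>K. \<forall>(x :: 'a) y. norm (cinner x y) \<le> norm x * norm y * K"
    by (intro exI[of _ 1]) (simp add: cinner_Cauchy_Schwarz)
qed (rule cinner_add_left)

interpretation cinner: bounded_bilinear "cinner :: 'a :: complex_hilbert \<Rightarrow> 'a \<Rightarrow> complex"
  by (rule cinner_bounded_bilinear)

lemma cinner_scaleC_right: "cinner x (c *\<^sub>C y) = cnj c * cinner x (y :: 'a :: complex_hilbert)"
  using cinner_scaleC_left[of c y x] cinner_commute[of x "c *\<^sub>C y"] cinner_commute[of x y] by simp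

lemma cinner_self: "cinner x x = complex_of_real ((norm (x :: 'a :: complex_hilbert))\<^sup>2)"
proof (rule complex_eqI)
  show "Im (cinner x x) = Im (complex_of_real ((norm x)\<^sup>2))"
    using arg_cong[OF cinner_commute[of x x], of Im] by simp
qed (simp add: Re_cinner power2_norm_eq_inner)

lemma cinner_eqI:
  fixes x x' :: "'a :: complex_hilbert"
  assumes "\<And>y. cinner x y = cinner x' y"
  shows "x = x'"
proof -
  have "inner (x - x') (x - x') = 0"
    using assms[of "x - x'"] by (simp add: Re_cinner[symmetric] cinner.diff_left)
  then show ?thesis by simp
qed

lemma norm_diff_sq: "(norm (x - y))\<^sup>2 = (norm x)\<^sup>2 - 2 * inner x y + (norm (y :: 'a :: real_inner))\<^sup>2"
  by (simp add: power2_norm_eq_inner inner_diff inner_commute)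

definition clinear :: "('a :: complex_normed_vector \<Rightarrow> 'b :: complex_normed_vector) \<Rightarrow> bool"
  where "clinear f \<longleftrightarrow> (\<forall>x y. f (x + y) = f x + f y) \<and> (\<forall>c x. f (c *\<^sub>C x) = c *\<^sub>C f x)"

lemma clinear_add: "clinear f \<Longrightarrow> f (x + y) = f x + f y"
  and clinear_scaleC: "clinear f \<Longrightarrow> f (c *\<^sub>C x) = c *\<^sub>C f x"
  by (simp_all add: clinear_def)

lemma clinear_linear: "clinear f \<Longrightarrow> linear f"
  by (auto intro!: linearI simp: clinear_def scaleR_scaleC)

lemma operators_clinear: "C \<in> operators \<Longrightarrow> clinear (blinfun_apply C)"
  by (simp add: clinear_def operators_def blinfun.add_right)

lemma operators_scaleC: "C \<in> operators \<Longrightarrow> blinfun_apply C (c *\<^sub>C x) = c *\<^sub>C blinfun_apply C x"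
  by (simp add: operators_def)

lemma clinear_Blinfun:
  assumes f: "clinear f" and bd: "\<And>x. norm (f x) \<le> K * norm x" and K: "0 \<le> K"
  obtains T where "T \<in> operators" "\<And>x. blinfun_apply T x = f x" "norm T \<le> K"
proof
  have "bounded_linear f"
    by (rule bounded_linear_intro[where K = K])
      (use bd in \<open>simp_all add: linear_add[OF clinear_linear[OF f]] linear_scale[OF clinear_linear[OF f]] mult.commute\<close>)
  then have T: "blinfun_apply (Blinfun f) = f" by (rule bounded_linear_Blinfun_apply)
  show "Blinfun f \<in> operators" using f T by (simp add: operators_def clinear_def)
  show "blinfun_apply (Blinfun f) x = f x" for x by (simp add: T)
  show "norm (Blinfun f) \<le> K" using K bd by (intro norm_blinfun_bound) (simp_all add: T)
qed

lemma linear_coeff_zero_of_quadratic_nonneg: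
  fixes d e :: real
  assumes nonneg: "\<And>t. 0 \<le> 2 * t * d + t\<^sup>2 * e"
  shows "d = 0"
proof -
  have e: "e \<ge> 0" using nonneg[of 1] nonneg[of "-1"] by simp
  define s where "s = d / (e + 1)"
  have s: "d = s * (e + 1)" using e by (simp add: s_def)
  have "0 \<le> 2 * (- s) * d + (- s)\<^sup>2 * e" by (rule nonneg)
  then have "s\<^sup>2 * (e + 2) \<le> 0" by (simp add: s power2_eq_square algebra_simps)
  then show ?thesis using e by (simp add: s mult_le_0_iff)
qed

text \<open>Minimise \<open>x \<mapsto> (norm (E x))\<^sup>2 - 2 * \<phi> x\<close>: by the parallelogram law the images under \<open>E\<close> of
  a minimising sequence form a Cauchy sequence, and its limit represents \<open>\<phi>\<close>. Minimising over
  the domain of \<open>E\<close> instead of over a subspace yields at once the representing vector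
  in the closure of the range.\<close>

lemma Riesz_on_range:
  fixes E :: "'v :: real_vector \<Rightarrow> 'h :: {real_inner,complete_space}" and \<phi> :: "'v \<Rightarrow> real"
  assumes E: "linear E" and \<phi>: "linear \<phi>" and bd: "\<And>x. \<bar>\<phi> x\<bar> \<le> M * norm (E x)"
  obtains v where "v \<in> closure (range E)" "\<And>x. \<phi> x = inner (E x) v"
proof -
  define J where "J x = (norm (E x))\<^sup>2 - 2 * \<phi> x" for x
  have "- M\<^sup>2 \<le> J x" for x
    using bd[of x] zero_le_power2[of "norm (E x) - M"]
    by (simp add: J_def power2_diff algebra_simps abs_le_iff)
  then have bdd: "bdd_below (range J)" by (auto intro!: bdd_belowI)
  define m where "m = Inf (range J)"
  have m_le: "m \<le> J x" for x unfolding m_def by (intro cInf_lower bdd) simp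
  have "\<exists>x. J x < m + inverse (Suc n)" for n
    using cInf_less_iff[OF _ bdd, of "m + inverse (Suc n)"] by (auto simp: m_def)
  then obtain X where X: "\<And>n. J (X n) < m + inverse (real (Suc n))" by metis
  have par: "(norm (E x - E y))\<^sup>2 \<le> 2 * (J x - m) + 2 * (J y - m)" for x y
  proof -
    have "J ((1/2) *\<^sub>R (x + y)) = (norm (E x + E y))\<^sup>2 / 4 - (\<phi> x + \<phi> y)"
      unfolding J_def linear_scale[OF E] linear_scale[OF \<phi>] linear_add[OF E] linear_add[OF \<phi>] norm_scaleR
      by (simp add: power_mult_distrib power2_eq_square field_simps)
    then have "4 * m \<le> (norm (E x + E y))\<^sup>2 - 4 * (\<phi> x + \<phi> y)"
      using m_le[of "(1/2) *\<^sub>R (x + y)"] by simp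
    moreover have "(norm (E x - E y))\<^sup>2 + (norm (E x + E y))\<^sup>2 = 2 * (norm (E x))\<^sup>2 + 2 * (norm (E y))\<^sup>2"
      by (simp add: power2_norm_eq_inner inner_diff inner_add inner_commute)
    ultimately show ?thesis by (simp add: J_def)
  qed
  have "Cauchy (\<lambda>n. E (X n))"
  proof (rule CauchyI)
    fix e :: real assume e: "e > 0"
    obtain N where N: "inverse (real (Suc N)) < e\<^sup>2 / 4"
      using reals_Archimedean[of "e\<^sup>2 / 4"] e by auto
    have small: "J (X n) - m < e\<^sup>2 / 4" if "n \<ge> N" for n
    proof -
      have "inverse (real (Suc n)) \<le> inverse (real (Suc N))" using that by simp
      then show ?thesis using X[of n] N by linarith
    qed
    show "\<exists>N. \<forall>k\<ge>N. \<forall>l\<ge>N. norm (E (X k) - E (X l)) < e"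
    proof (intro exI allI impI)
      fix k l assume "N \<le> k" "N \<le> l"
      then have "2 * (J (X k) - m) + 2 * (J (X l) - m) < e\<^sup>2"
        using small[of k] small[of l] by simp
      with par[of "X k" "X l"] have "(norm (E (X k) - E (X l)))\<^sup>2 < e\<^sup>2"
        by (rule le_less_trans)
      then show "norm (E (X k) - E (X l)) < e"
        by (rule power2_less_imp_less) (use e in simp)
    qed
  qed
  then obtain v where v: "(\<lambda>n. E (X n)) \<longlonglongrightarrow> v"
    using Cauchy_convergent convergent_def by blast
  show ?thesis
  proof
    show "v \<in> closure (range E)"
      using v unfolding closure_sequential by (intro exI[of _ "\<lambda>n. E (X n)"]) simp
    fix x
    have "inner v (E x) - \<phi> x = 0"
    proof (rule linear_coeff_zero_of_quadratic_nonneg)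
      fix t
      have "m \<le> J (X n) + 2 * t * (inner (E (X n)) (E x) - \<phi> x) + t\<^sup>2 * (norm (E x))\<^sup>2" for n
      proof -
        have "J (X n + t *\<^sub>R x) = J (X n) + 2 * t * (inner (E (X n)) (E x) - \<phi> x) + t\<^sup>2 * (norm (E x))\<^sup>2"
          unfolding J_def linear_add[OF E] linear_add[OF \<phi>] linear_scale[OF E] linear_scale[OF \<phi>]
            power2_norm_eq_inner
          by (simp add: inner_add inner_commute algebra_simps power2_eq_square del: dot_square_norm)
        with m_le[of "X n + t *\<^sub>R x"] show ?thesis by simp
      qed
      then have "0 \<le> inverse (real (Suc n)) + 2 * t * (inner (E (X n)) (E x) - \<phi> x) + t\<^sup>2 * (norm (E x))\<^sup>2"
        for n using X[of n] by (smt (verit, best))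
      moreover have "(\<lambda>n. inverse (real (Suc n)) + 2 * t * (inner (E (X n)) (E x) - \<phi> x) + t\<^sup>2 * (norm (E x))\<^sup>2)
          \<longlonglongrightarrow> 0 + 2 * t * (inner v (E x) - \<phi> x) + t\<^sup>2 * (norm (E x))\<^sup>2"
        by (intro tendsto_intros v LIMSEQ_inverse_real_of_nat)
      ultimately show "0 \<le> 2 * t * (inner v (E x) - \<phi> x) + t\<^sup>2 * (norm (E x))\<^sup>2"
        using LIMSEQ_le_const by (smt (verit, best))
    qed
    then show "\<phi> x = inner (E x) v" by (simp add: inner_commute)
  qed
qed

lemma inner_le_on_closure:
  assumes "\<And>w. w \<in> S \<Longrightarrow> inner w v \<le> N * norm w" and "w \<in> closure S"
  shows "inner w v \<le> N * norm w"
proof -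
  have "closed {w. inner w v \<le> N * norm w}"
    by (intro closed_Collect_le continuous_intros)
  then have "closure S \<subseteq> {w. inner w v \<le> N * norm w}"
    using assms(1) by (intro closure_minimal) auto
  with assms(2) show ?thesis by auto
qed

lemma closure_range_clinear:
  assumes E: "clinear (E :: 'v :: complex_normed_vector \<Rightarrow> 'h :: complex_normed_vector)"
  shows closure_range_add: "u \<in> closure (range E) \<Longrightarrow> v \<in> closure (range E) \<Longrightarrow> u + v \<in> closure (range E)"
    and closure_range_scaleC: "u \<in> closure (range E) \<Longrightarrow> c *\<^sub>C u \<in> closure (range E)"
proof -
  show "u + v \<in> closure (range E)" if uv: "u \<in> closure (range E)" "v \<in> closure (range E)"
  proof -
    obtain x y where "\<And>n. x n \<in> range E" "x \<longlonglongrightarrow> u" "\<And>n. y n \<in> range E" "y \<longlonglongrightarrow> v"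
      using uv by (auto simp: closure_sequential)
    moreover from this have "x n + y n \<in> range E" for n
      by (metis (mono_tags, lifting) clinear_add[OF E] rangeE rangeI)
    ultimately show ?thesis
      using tendsto_add unfolding closure_sequential by (metis (mono_tags, lifting))
  qed
  show "c *\<^sub>C u \<in> closure (range E)" if u: "u \<in> closure (range E)"
  proof -
    obtain x where "\<And>n. x n \<in> range E" "x \<longlonglongrightarrow> u"
      using u by (auto simp: closure_sequential)
    moreover from this have "c *\<^sub>C x n \<in> range E" for n
      by (metis (mono_tags, lifting) clinear_scaleC[OF E] rangeE rangeI)
    ultimately show ?thesis
      using scaleC.tendsto[OF tendsto_const, of x u sequentially c] unfolding closure_sequential
      by (metis (mono_tags, lifting))
  qed
qed

lemma closure_range_unique:
  fixes E :: "'v :: complex_normed_vector \<Rightarrow> 'h :: complex_hilbert"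
  assumes E: "clinear E" and u: "u \<in> closure (range E)" and v: "v \<in> closure (range E)"
    and eq: "\<And>x. cinner (E x) u = cinner (E x) v"
  shows "u = v"
proof -
  have "u + (-1) *\<^sub>C v \<in> closure (range E)"
    using u v by (intro closure_range_add[OF E] closure_range_scaleC[OF E])
  moreover have "(-1) *\<^sub>C v = - v"
    using scaleR_scaleC[of "-1" v] by simp
  ultimately have "u - v \<in> closure (range E)" by simp
  moreover have "inner w (u - v) \<le> 0 * norm w" if "w \<in> range E" for w
  proof -
    obtain x where "w = E x" using \<open>w \<in> range E\<close> by blast
    then have "cinner w (u - v) = 0" using eq by (simp add: cinner.diff_right)
    then show ?thesis by (metis Re_cinner mult_zero_left order_refl zero_complex.simps(1))
  qed
  ultimately have "inner (u - v) (u - v) \<le> 0 * norm (u - v)"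
    by (rule inner_le_on_closure[rotated])
  then have "inner (u - v) (u - v) = 0" using inner_ge_zero[of "u - v"] by simp
  then show ?thesis by simp
qed

text \<open>The one representation result behind adjoints, Taylor coefficients and factorisations.
  Since the representing vectors lie in the closure of the range of \<open>E\<close>, they are unique, and this
  makes them depend linearly on \<open>k\<close>.\<close>

lemma sesquilinear_representation:
  fixes E :: "'v :: complex_normed_vector \<Rightarrow> 'h :: complex_hilbert"
    and \<beta> :: "'v \<Rightarrow> 'k :: complex_normed_vector \<Rightarrow> complex"
  assumes E: "clinear E" and left: "\<And>k. clinear (\<lambda>x. \<beta> x k)"
    and right: "\<And>x. clinear (\<lambda>k. cnj (\<beta> x k))"
    and bd: "\<And>x k. cmod (\<beta> x k) \<le> N k * norm (E x)" and N: "\<And>k. 0 \<le> N k"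
  obtains Z where "clinear Z" "\<And>k. Z k \<in> closure (range E)" "\<And>k. norm (Z k) \<le> N k"
    "\<And>x k. \<beta> x k = cinner (E x) (Z k)"
proof -
  have "\<exists>v. v \<in> closure (range E) \<and> (\<forall>x. \<beta> x k = cinner (E x) v)" for k
  proof -
    have "linear (\<lambda>x. Re (\<beta> x k))"
      using linear_compose[OF clinear_linear[OF left[of k]], of Re]
      by (simp add: o_def bounded_linear.linear[OF bounded_linear_Re])
    moreover have "\<bar>Re (\<beta> x k)\<bar> \<le> N k * norm (E x)" for x
      using abs_Re_le_cmod[of "\<beta> x k"] bd[of x k] by linarith
    ultimately obtain v where v: "v \<in> closure (range E)" "\<And>x. Re (\<beta> x k) = inner (E x) v"
      using Riesz_on_range[OF clinear_linear[OF E]] by blast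
    have "\<beta> x k = cinner (E x) v" for x
    proof (rule complex_eqI)
      show "Re (\<beta> x k) = Re (cinner (E x) v)" by (simp add: v Re_cinner)
      have "Re (\<beta> (\<i> *\<^sub>C x) k) = Re (cinner (E (\<i> *\<^sub>C x)) v)" by (simp add: v Re_cinner)
      then show "Im (\<beta> x k) = Im (cinner (E x) v)"
        by (simp add: clinear_scaleC[OF E] clinear_scaleC[OF left] cinner_scaleC_left scaleC_complex_def)
    qed
    with v show ?thesis by blast
  qed
  then obtain Z where Z: "\<And>k. Z k \<in> closure (range E)" "\<And>x k. \<beta> x k = cinner (E x) (Z k)"
    by metis
  show ?thesis
  proof (rule that[OF _ Z(1) _ Z(2)])
    show "clinear Z"
      unfolding clinear_def
    proof (intro conjI allI)
      fix k l c
      have "cnj (\<beta> x (k + l)) = cnj (\<beta> x k) + cnj (\<beta> x l)" for x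
        by (rule clinear_add[OF right])
      then have "\<beta> x (k + l) = \<beta> x k + \<beta> x l" for x
        by (metis complex_cnj_add complex_cnj_cnj)
      then show "Z (k + l) = Z k + Z l"
        by (intro closure_range_unique[OF E] Z closure_range_add[OF E])
           (simp add: Z(2) cinner.add_right)
      have "cnj (\<beta> x (c *\<^sub>C k)) = c * cnj (\<beta> x k)" for x
        using clinear_scaleC[OF right, of x c k] by (simp add: scaleC_complex_def)
      then have "\<beta> x (c *\<^sub>C k) = cnj c * \<beta> x k" for x
        by (metis complex_cnj_mult complex_cnj_cnj)
      then show "Z (c *\<^sub>C k) = c *\<^sub>C Z k"
        by (intro closure_range_unique[OF E] Z closure_range_scaleC[OF E])
           (simp add: Z(2) cinner_scaleC_right)
    qed
    fix k
    have "inner (E x) (Z k) \<le> N k * norm (E x)" for x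
      using bd[of x k] complex_Re_le_cmod[of "\<beta> x k"] by (simp add: Re_cinner[symmetric] Z)
    then have "inner (Z k) (Z k) \<le> N k * norm (Z k)"
      using Z(1)[of k] inner_le_on_closure[of "range E" "Z k" "N k" "Z k"] by blast
    then have "norm (Z k) * norm (Z k) \<le> N k * norm (Z k)"
      by (simp add: dot_square_norm power2_eq_square)
    then show "norm (Z k) \<le> N k"
      using N[of k] by (cases "Z k = 0") auto
  qed
qed

section \<open>Adjoints\<close>

lemma ex_adjoint:
  fixes C :: "'a :: complex_hilbert \<Rightarrow>\<^sub>L 'b :: complex_hilbert"
  assumes C: "C \<in> operators"
  obtains A where "A \<in> operators" "\<And>x y. cinner (blinfun_apply C x) y = cinner x (blinfun_apply A y)"
    "norm A \<le> norm C"
proof -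
  have left: "clinear (\<lambda>x. cinner (C x) y)" for y
    by (simp add: clinear_def blinfun.add_right cinner.add_left operators_scaleC[OF C]
        cinner_scaleC_left scaleC_complex_def)
  have right: "clinear (\<lambda>y. cnj (cinner (C x) y))" for x
    by (simp add: clinear_def cinner.add_right cinner_scaleC_right scaleC_complex_def)
  have bd: "cmod (cinner (C x) y) \<le> (norm C * norm y) * norm x" for x y
  proof -
    have "cmod (cinner (C x) y) \<le> norm (C x) * norm y" by (rule cinner_Cauchy_Schwarz)
    also have "\<dots> \<le> (norm C * norm x) * norm y" by (intro mult_right_mono norm_blinfun) simp
    finally show ?thesis by (simp only: mult_ac)
  qed
  have id: "clinear (\<lambda>x :: 'a. x)" by (simp add: clinear_def)
  show ?thesis
  proof (rule sesquilinear_representation[OF id left right bd])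
    fix Z assume Z: "clinear Z" "\<And>y. norm (Z y) \<le> norm C * norm y"
      "\<And>x y. cinner (C x) y = cinner x (Z y)"
    show ?thesis
      by (rule clinear_Blinfun[OF Z(1,2) norm_ge_zero], rule that) (simp_all only: Z(3))
  qed simp
qed

lemma hilbert_adjoint:
  fixes C :: "'a :: complex_hilbert \<Rightarrow>\<^sub>L 'b :: complex_hilbert"
  assumes C: "C \<in> operators"
  shows hilbert_adjoint_operators: "hilbert_adjoint C \<in> operators"
    and cinner_hilbert_adjoint:
      "cinner (blinfun_apply C x) y = cinner x (blinfun_apply (hilbert_adjoint C) y)"
    and norm_hilbert_adjoint_le: "norm (hilbert_adjoint C) \<le> norm C"
proof -
  obtain A where A: "A \<in> operators" "\<And>x y. cinner (blinfun_apply C x) y = cinner x (blinfun_apply A y)"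
    "norm A \<le> norm C" using ex_adjoint[OF C] by blast
  have "hilbert_adjoint C = A"
    unfolding hilbert_adjoint_def
  proof (rule the_equality)
    fix B assume B: "B \<in> operators \<and> (\<forall>x y. cinner (C x) y = cinner x (blinfun_apply B y))"
    show "B = A"
    proof (rule blinfun_eqI, rule cinner_eqI)
      fix y x
      have "cinner x (B y) = cinner x (A y)" using A(2)[of x y] B by simp
      then show "cinner (B y) x = cinner (A y) x"
        by (simp only: cinner_commute[of _ x])
    qed
  qed (use A in auto)
  with A show "hilbert_adjoint C \<in> operators" "norm (hilbert_adjoint C) \<le> norm C"
    "cinner (blinfun_apply C x) y = cinner x (blinfun_apply (hilbert_adjoint C) y)" by simp_all
qed

section \<open>Positive square roots\<close>

interpretation blinfun_compose: bounded_bilinear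
  "(o\<^sub>L) :: ('b :: real_normed_vector \<Rightarrow>\<^sub>L 'c :: real_normed_vector) \<Rightarrow> ('a :: real_normed_vector \<Rightarrow>\<^sub>L 'b) \<Rightarrow> _"
  by (rule bounded_bilinear_blinfun_compose)

lemma blinfun_compose_assoc: "(A o\<^sub>L B) o\<^sub>L C = A o\<^sub>L (B o\<^sub>L C)"
  by (rule blinfun_eqI) simp

lemma blinfun_compose_id [simp]: "id_blinfun o\<^sub>L A = A" "A o\<^sub>L id_blinfun = A"
  by (rule blinfun_eqI, simp)+

lemma operators_algebra:
  shows operators_id: "id_blinfun \<in> operators"
    and operators_zero: "0 \<in> operators"
    and operators_compose: "A \<in> operators \<Longrightarrow> B \<in> operators \<Longrightarrow> A o\<^sub>L B \<in> operators"
    and operators_add: "C \<in> operators \<Longrightarrow> D \<in> operators \<Longrightarrow> C + D \<in> operators"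
    and operators_diff: "C \<in> operators \<Longrightarrow> D \<in> operators \<Longrightarrow> C - D \<in> operators"
    and operators_scaleR: "C \<in> operators \<Longrightarrow> r *\<^sub>R C \<in> operators"
  by (simp_all add: operators_def blinfun.add_left blinfun.diff_left blinfun.scaleR_left
      scaleC_add_right scaleC.diff_right scaleC.scaleR_right scaleC.zero_right)

lemma closed_operators: "closed operators"
proof -
  have "operators = (\<Inter>c. \<Inter>x. {C. blinfun_apply C (c *\<^sub>C x) = c *\<^sub>C blinfun_apply C x})"
    by (auto simp: operators_def)
  also have "closed \<dots>"
    by (intro closed_INT ballI closed_Collect_eq continuous_intros
        bounded_linear.continuous_on[OF scaleC.bounded_linear_right])
  finally show ?thesis .
qed

text \<open>The operators \<open>p(T)\<close> for polynomials \<open>p\<close> without constant term and with nonnegative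
  coefficients, each paired with \<open>p(1)\<close>. As the coefficients are nonnegative, \<open>p(1)\<close> bounds the
  norm of \<open>p(T)\<close> for a contraction \<open>T\<close>.\<close>

inductive_set positive_polynomials ::
    "('a :: real_normed_vector \<Rightarrow>\<^sub>L 'a) \<Rightarrow> (('a \<Rightarrow>\<^sub>L 'a) \<times> real) set" for T
  where
    base: "(T, 1) \<in> positive_polynomials T"
  | zero: "(0, 0) \<in> positive_polynomials T"
  | add: "(X, s) \<in> positive_polynomials T \<Longrightarrow> (Y, t) \<in> positive_polynomials T \<Longrightarrow>
      (X + Y, s + t) \<in> positive_polynomials T"
  | compose: "(X, s) \<in> positive_polynomials T \<Longrightarrow> (Y, t) \<in> positive_polynomials T \<Longrightarrow>
      (X o\<^sub>L Y, s * t) \<in> positive_polynomials T"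
  | scale: "(X, s) \<in> positive_polynomials T \<Longrightarrow> 0 \<le> c \<Longrightarrow>
      (c *\<^sub>R X, c * s) \<in> positive_polynomials T"

lemma positive_polynomials_norm:
  assumes "(X, s) \<in> positive_polynomials T" and T: "norm T \<le> 1"
  shows "norm X \<le> s"
  using assms(1)
proof induction
  case (add X s Y t)
  then show ?case using norm_triangle_ineq[of X Y] by simp
next
  case (compose X s Y t)
  have "norm (X o\<^sub>L Y) \<le> norm X * norm Y" by (rule norm_blinfun_compose)
  also have "\<dots> \<le> s * t" using compose.IH order_trans[OF norm_ge_zero compose.IH(1)] by (intro mult_mono) auto
  finally show ?case .
qed (use T in \<open>auto intro: mult_left_mono\<close>)

lemma positive_polynomials_commute:
  assumes "(X, s) \<in> positive_polynomials T" and "T o\<^sub>L S = S o\<^sub>L T"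
  shows "X o\<^sub>L S = S o\<^sub>L X"
  using assms(1)
proof induction
  case (compose X s Y t)
  have "(X o\<^sub>L Y) o\<^sub>L S = X o\<^sub>L (S o\<^sub>L Y)" by (simp add: blinfun_compose_assoc compose.IH)
  also have "\<dots> = S o\<^sub>L (X o\<^sub>L Y)" by (simp add: blinfun_compose_assoc[symmetric] compose.IH)
  finally show ?case .
qed (use assms(2) in \<open>simp_all add: blinfun_compose.add_left blinfun_compose.add_right
    blinfun_compose.scaleR_left blinfun_compose.scaleR_right
    blinfun_compose.zero_left blinfun_compose.zero_right\<close>)

lemma positive_polynomials_operators:
  assumes "(X, s) \<in> positive_polynomials T" and "T \<in> operators"
  shows "X \<in> operators"
  using assms(1)
  by induction (auto intro: assms(2) operators_algebra)

definition self_adjoint :: "('a :: complex_hilbert \<Rightarrow>\<^sub>L 'a) \<Rightarrow> bool"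
  where "self_adjoint A \<longleftrightarrow>
    (\<forall>x y. cinner (blinfun_apply A x) y = cinner x (blinfun_apply A y))"

lemma self_adjointD:
  "self_adjoint A \<Longrightarrow> cinner (blinfun_apply A x) y = cinner x (blinfun_apply A y)"
  by (simp add: self_adjoint_def)

lemma positive_polynomials_self_adjoint:
  assumes "(X, s) \<in> positive_polynomials T" and T: "self_adjoint T"
  shows "self_adjoint X"
  using assms(1)
proof induction
  case (compose X s Y t)
  have "(X o\<^sub>L Y) = Y o\<^sub>L X"
    using positive_polynomials_commute[OF compose(2)] positive_polynomials_commute[OF compose(1)]
    by metis
  with compose.IH show ?case
    unfolding self_adjoint_def by (metis blinfun_apply_blinfun_compose)
qed (use T in \<open>auto simp: self_adjoint_def blinfun.add_left blinfun.scaleR_left cinner.add_left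
    cinner.add_right cinner.scaleR_left cinner.scaleR_right cinner.zero_left cinner.zero_right\<close>)

lemma closed_self_adjoint: "closed {A. self_adjoint A}"
proof -
  have "{A. self_adjoint A} =
      (\<Inter>x. \<Inter>y. {A. cinner (blinfun_apply A x) y = cinner x (blinfun_apply A y)})"
    by (auto simp: self_adjoint_def)
  also have "closed \<dots>"
    by (intro closed_INT ballI closed_Collect_eq continuous_intros
        bounded_linear.continuous_on[OF cinner.bounded_linear_right]
        bounded_linear.continuous_on[OF cinner.bounded_linear_left])
  finally show ?thesis .
qed

text \<open>A fixed point \<open>S\<close> of \<open>X \<mapsto> (T + X\<^sup>2) / 2\<close> satisfies \<open>(I - S)\<^sup>2 = I - T\<close>. The iterates from \<open>0\<close>, and
  also their increments, are polynomials in \<open>T\<close> with nonnegative coefficients, so their convergence follows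
  from that of the scalar iteration for \<open>T = 1\<close>.\<close>

fun sqrt_iterate :: "('a :: real_normed_vector \<Rightarrow>\<^sub>L 'a) \<Rightarrow> nat \<Rightarrow> ('a \<Rightarrow>\<^sub>L 'a)"
  where
    "sqrt_iterate T 0 = 0"
  | "sqrt_iterate T (Suc n) = (1/2) *\<^sub>R (T + (sqrt_iterate T n o\<^sub>L sqrt_iterate T n))"

fun sqrt_iterate_one :: "nat \<Rightarrow> real"
  where
    "sqrt_iterate_one 0 = 0"
  | "sqrt_iterate_one (Suc n) = (1/2) * (1 + sqrt_iterate_one n * sqrt_iterate_one n)"

lemma sqrt_iterate_positive:
  "(sqrt_iterate T n, sqrt_iterate_one n) \<in> positive_polynomials T"
proof (induction n)
  case (Suc n)
  then show ?case
    unfolding sqrt_iterate.simps sqrt_iterate_one.simps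
    by (intro positive_polynomials.intros) simp_all
qed (simp add: positive_polynomials.zero)

lemma sqrt_iterate_increment:
  "(sqrt_iterate T (Suc n) - sqrt_iterate T n, sqrt_iterate_one (Suc n) - sqrt_iterate_one n)
    \<in> positive_polynomials T"
proof (induction n)
  case 0
  show ?case using positive_polynomials.scale[OF positive_polynomials.base, of "1/2" T] by (simp add: blinfun_compose.zero_left)
next
  case (Suc n)
  let ?X = "sqrt_iterate T n" and ?Y = "sqrt_iterate T (Suc n)"
  let ?s = "sqrt_iterate_one n" and ?t = "sqrt_iterate_one (Suc n)"
  have "?Y o\<^sub>L ?X = ?X o\<^sub>L ?Y"
    using positive_polynomials_commute[OF sqrt_iterate_positive[of T "Suc n"]]
      positive_polynomials_commute[OF sqrt_iterate_positive[of T n]] by metis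
  then have "sqrt_iterate T (Suc (Suc n)) - ?Y = (1/2) *\<^sub>R ((?Y - ?X) o\<^sub>L (?Y + ?X))"
    unfolding sqrt_iterate.simps(2)[of T "Suc n"] sqrt_iterate.simps(2)[of T n]
    by (simp del: sqrt_iterate.simps add: blinfun_compose.diff_left blinfun_compose.add_right
        algebra_simps)
  moreover have "sqrt_iterate_one (Suc (Suc n)) - ?t = (1/2) * ((?t - ?s) * (?t + ?s))"
    unfolding sqrt_iterate_one.simps(2)[of "Suc n"] by (simp add: algebra_simps)
  moreover have "((1/2) *\<^sub>R ((?Y - ?X) o\<^sub>L (?Y + ?X)), (1/2) * ((?t - ?s) * (?t + ?s)))
      \<in> positive_polynomials T"
    by (intro positive_polynomials.scale positive_polynomials.compose positive_polynomials.add
        Suc sqrt_iterate_positive) simp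
  ultimately show ?case by (simp only:)
qed

lemma sqrt_iterate_difference:
  "n \<le> m \<Longrightarrow> (sqrt_iterate T m - sqrt_iterate T n, sqrt_iterate_one m - sqrt_iterate_one n)
    \<in> positive_polynomials T"
proof (induction m rule: dec_induct)
  case base
  then show ?case by (simp add: positive_polynomials.zero)
next
  case (step m)
  show ?case
    using positive_polynomials.add[OF step.IH sqrt_iterate_increment[of T m]]
    by (simp del: sqrt_iterate.simps sqrt_iterate_one.simps)
qed

lemma sqrt_iterate_one_bounds: "0 \<le> sqrt_iterate_one n" "sqrt_iterate_one n \<le> 1"
proof (induction n)
  case (Suc n)
  then show "0 \<le> sqrt_iterate_one (Suc n)" "sqrt_iterate_one (Suc n) \<le> 1"
    using mult_mono[of "sqrt_iterate_one n" 1 "sqrt_iterate_one n" 1] by simp_all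
qed simp_all

lemma sqrt_iterate_convergent:
  fixes T :: "'a :: banach \<Rightarrow>\<^sub>L 'a"
  assumes T: "norm T \<le> 1"
  shows "convergent (sqrt_iterate T)"
proof -
  have mono: "sqrt_iterate_one n \<le> sqrt_iterate_one m" if "n \<le> m" for n m
    using order_trans[OF norm_ge_zero positive_polynomials_norm[OF sqrt_iterate_difference[OF that] T]]
    by simp
  have "convergent sqrt_iterate_one"
    by (rule Bseq_mono_convergent) (auto intro!: BseqI'[of _ 1] mono simp: sqrt_iterate_one_bounds)
  then have cauchy: "Cauchy sqrt_iterate_one" by (rule convergent_Cauchy)
  have "Cauchy (sqrt_iterate T)"
  proof (rule CauchyI)
    fix e :: real assume "e > 0"
    then obtain N where N: "\<forall>m\<ge>N. \<forall>n\<ge>N. norm (sqrt_iterate_one m - sqrt_iterate_one n) < e"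
      using CauchyD[OF cauchy] by blast
    have *: "norm (sqrt_iterate T m - sqrt_iterate T n) < e" if "n \<le> m" "n \<ge> N" for n m
    proof -
      have "norm (sqrt_iterate T m - sqrt_iterate T n) \<le> sqrt_iterate_one m - sqrt_iterate_one n"
        by (rule positive_polynomials_norm[OF sqrt_iterate_difference[OF that(1)] T])
      also have "\<dots> \<le> norm (sqrt_iterate_one m - sqrt_iterate_one n)" by simp
      also have "\<dots> < e" using N that by simp
      finally show ?thesis .
    qed
    show "\<exists>N. \<forall>m\<ge>N. \<forall>n\<ge>N. norm (sqrt_iterate T m - sqrt_iterate T n) < e"
    proof (intro exI[of _ N] allI impI)
      fix m n assume "N \<le> m" "N \<le> n"
      then show "norm (sqrt_iterate T m - sqrt_iterate T n) < e"
        using *[of m n] *[of n m] by (cases "n \<le> m") (simp_all add: norm_minus_commute)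
    qed
  qed
  then show ?thesis by (rule Cauchy_convergent)
qed

lemma ex_commuting_sqrt:
  fixes T :: "'a :: complex_hilbert \<Rightarrow>\<^sub>L 'a"
  assumes T: "T \<in> operators" "norm T \<le> 1" "self_adjoint T"
  obtains R where "positive_operator R" "R o\<^sub>L R = id_blinfun - T"
    "\<And>A. T o\<^sub>L A = A o\<^sub>L T \<Longrightarrow> R o\<^sub>L A = A o\<^sub>L R"
proof -
  obtain S where lim: "sqrt_iterate T \<longlonglongrightarrow> S"
    using sqrt_iterate_convergent[OF T(2)] convergent_def by blast
  have norm: "norm S \<le> 1"
    using positive_polynomials_norm[OF sqrt_iterate_positive T(2)] sqrt_iterate_one_bounds(2)
    by (intro LIMSEQ_le_const2[OF tendsto_norm[OF lim]]) (meson order_trans)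
  have "S \<in> operators"
    using positive_polynomials_operators[OF sqrt_iterate_positive T(1)]
    by (intro closed_sequentially[OF closed_operators _ lim]) blast
  have "S \<in> {A. self_adjoint A}"
    using positive_polynomials_self_adjoint[OF sqrt_iterate_positive T(3)]
    by (intro closed_sequentially[OF closed_self_adjoint _ lim]) blast
  then have sa: "self_adjoint S" by simp
  have comm: "S o\<^sub>L A = A o\<^sub>L S" if A: "T o\<^sub>L A = A o\<^sub>L T" for A
  proof (rule LIMSEQ_unique)
    show "(\<lambda>n. sqrt_iterate T n o\<^sub>L A) \<longlonglongrightarrow> (S o\<^sub>L A)" by (intro tendsto_intros lim)
    show "(\<lambda>n. sqrt_iterate T n o\<^sub>L A) \<longlonglongrightarrow> (A o\<^sub>L S)"
      unfolding positive_polynomials_commute[OF sqrt_iterate_positive A] by (intro tendsto_intros lim)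
  qed
  have fix_eq: "S = (1/2) *\<^sub>R (T + (S o\<^sub>L S))"
  proof (rule LIMSEQ_unique[OF LIMSEQ_Suc[OF lim]])
    show "(\<lambda>n. sqrt_iterate T (Suc n)) \<longlonglongrightarrow> (1/2) *\<^sub>R (T + (S o\<^sub>L S))"
      unfolding sqrt_iterate.simps by (intro tendsto_intros lim)
  qed
  have double: "S + S = T + (S o\<^sub>L S)"
    using arg_cong[OF fix_eq, of "\<lambda>X. 2 *\<^sub>R X"] by (simp add: scaleR_2)
  show ?thesis
  proof (rule that[of "id_blinfun - S"])
    show "positive_operator (id_blinfun - S)"
      unfolding positive_operator_def
    proof (intro conjI allI)
      show "id_blinfun - S \<in> operators" by (intro operators_diff operators_id \<open>S \<in> operators\<close>)
      fix x
      have "cinner (S x) x = cnj (cinner (S x) x)"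
        using self_adjointD[OF sa, of x x] cinner_commute[of x "S x"] by simp
      then have im: "Im (cinner (S x) x) = 0"
        by (metis add.inverse_neutral complex_cnj_cancel_iff cnj.sel(2) equal_neg_zero)
      have "Re (cinner (S x) x) \<le> norm (S x) * norm x"
        using complex_Re_le_cmod cinner_Cauchy_Schwarz order_trans by blast
      also have "\<dots> \<le> (1 * norm x) * norm x"
        using norm by (intro mult_right_mono order_trans[OF norm_blinfun] mult_right_mono) auto
      finally have "Re (cinner (S x) x) \<le> (norm x)\<^sup>2" by (simp add: power2_eq_square)
      with im show "cinner ((id_blinfun - S) x) x \<in> nonneg_Reals"
        by (simp add: complex_nonneg_Reals_iff blinfun.diff_left cinner.diff_left cinner_self)
    qed
    show "(id_blinfun - S) o\<^sub>L (id_blinfun - S) = id_blinfun - T"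
      using double by (simp add: blinfun_compose.diff_left blinfun_compose.diff_right algebra_simps)
    show "(id_blinfun - S) o\<^sub>L A = A o\<^sub>L (id_blinfun - S)" if "T o\<^sub>L A = A o\<^sub>L T" for A
      using comm[OF that] by (simp add: blinfun_compose.diff_left blinfun_compose.diff_right)
  qed
qed

text \<open>Polarisation: the imaginary parts of the form at \<open>x + y\<close> and at \<open>x + \<i> y\<close> vanish.\<close>

lemma positive_operator_self_adjoint:
  assumes R: "positive_operator R"
  shows "self_adjoint R"
  unfolding self_adjoint_def
proof (intro allI)
  fix x y
  have op: "R \<in> operators" and real: "Im (cinner (R z) z) = 0" for z
    using R by (auto simp: positive_operator_def complex_nonneg_Reals_iff)
  have "Im (cinner (R x) y) + Im (cinner (R y) x) = 0"
    using real[of "x + y"] real[of x] real[of y]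
    by (simp add: blinfun.add_right cinner.add_left cinner.add_right)
  moreover have "Re (cinner (R y) x) = Re (cinner (R x) y)"
    using real[of "x + \<i> *\<^sub>C y"] real[of x] real[of "\<i> *\<^sub>C y"]
    by (simp add: blinfun.add_right cinner.add_left cinner.add_right operators_scaleC[OF op]
        cinner_scaleC_left cinner_scaleC_right)
  ultimately have "cinner (R x) y = cnj (cinner (R y) x)"
    by (intro complex_eqI) simp_all
  then show "cinner (R x) y = cinner x (R y)" by (simp add: cinner_commute[of x])
qed

text \<open>At a zero the form is minimal, so its derivative in the direction \<open>R v\<close> vanishes.\<close>

lemma positive_operator_null:
  assumes R: "positive_operator R" and null: "Re (cinner (blinfun_apply R v) v) = 0"
  shows "blinfun_apply R v = 0"
proof -
  have "Re (cinner (R v) (R v)) = 0"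
  proof (rule linear_coeff_zero_of_quadratic_nonneg)
    fix t :: real
    have "0 \<le> Re (cinner (R (v + t *\<^sub>R R v)) (v + t *\<^sub>R R v))"
      using R by (simp add: positive_operator_def complex_nonneg_Reals_iff)
    also have "\<dots> = 2 * t * Re (cinner (R v) (R v)) + t\<^sup>2 * Re (cinner (R (R v)) (R v))"
      using null self_adjointD[OF positive_operator_self_adjoint[OF R], of "R v" v]
      by (simp add: blinfun.add_right blinfun.scaleR_right cinner.add_left cinner.add_right
          cinner.scaleR_left cinner.scaleR_right power2_eq_square algebra_simps)
    finally show "0 \<le> 2 * t * Re (cinner (R v) (R v)) + t\<^sup>2 * Re (cinner (R (R v)) (R v))" .
  qed
  then show ?thesis by (simp add: cinner_self)
qed

text \<open>On \<open>w = (R - S) x\<close> the operator \<open>R + S\<close> vanishes, because \<open>(R + S) (R - S) = R\<^sup>2 - S\<^sup>2\<close> for commuting operators. Two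
  nonnegative forms with sum zero at \<open>w\<close> both vanish there, hence \<open>R w = S w = 0\<close>, and so
  \<open>w\<close> is orthogonal to itself.\<close>

lemma positive_sqrt_unique:
  assumes R: "positive_operator R" and S: "positive_operator S"
    and eq: "R o\<^sub>L R = S o\<^sub>L S" and comm: "R o\<^sub>L S = S o\<^sub>L R"
  shows "R = S"
proof (rule blinfun_eqI)
  fix x
  define w where "w = R x - S x"
  have "R w + S w = (R o\<^sub>L R) x - (S o\<^sub>L S) x - ((R o\<^sub>L S) x - (S o\<^sub>L R) x)"
    by (simp add: w_def blinfun.diff_right)
  then have RSw: "R w + S w = 0" by (simp add: eq comm)
  then have "cinner (R w) w + cinner (S w) w = 0"
    by (simp add: cinner.add_left[symmetric] cinner.zero_left)
  moreover have "Re (cinner (R w) w) \<ge> 0" "Re (cinner (S w) w) \<ge> 0"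
    using R S by (simp_all add: positive_operator_def complex_nonneg_Reals_iff)
  ultimately have "Re (cinner (R w) w) = 0" "Re (cinner (S w) w) = 0"
    by (smt (verit) plus_complex.sel(1) zero_complex.sel(1))+
  then have "R w = 0" "S w = 0"
    using positive_operator_null R S by blast+
  then have "cinner w w = 0"
    using self_adjointD[OF positive_operator_self_adjoint[OF R], of x w]
      self_adjointD[OF positive_operator_self_adjoint[OF S], of x w]
    by (subst (1) w_def) (simp add: cinner.diff_left cinner.zero_right)
  then show "R x = S x" by (simp add: cinner_self w_def)
qed

lemma operator_sqrt:
  fixes T :: "'a :: complex_hilbert \<Rightarrow>\<^sub>L 'a"
  assumes T: "T \<in> operators" "norm T \<le> 1" "self_adjoint T"
  shows positive_operator_sqrt: "positive_operator (operator_sqrt (id_blinfun - T))"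
    and operator_sqrt_square:
      "operator_sqrt (id_blinfun - T) o\<^sub>L operator_sqrt (id_blinfun - T) = id_blinfun - T"
proof -
  obtain R where R: "positive_operator R" "R o\<^sub>L R = id_blinfun - T"
    "\<And>A. T o\<^sub>L A = A o\<^sub>L T \<Longrightarrow> R o\<^sub>L A = A o\<^sub>L R" using ex_commuting_sqrt[OF T] by blast
  have "operator_sqrt (id_blinfun - T) = R"
    unfolding operator_sqrt_def
  proof (rule the_equality)
    fix S assume S: "positive_operator S \<and> S o\<^sub>L S = id_blinfun - T"
    \<comment> \<open>Every square root commutes with \<open>T\<close>, hence with the root constructed above.\<close>
    then have T_eq: "T = id_blinfun - (S o\<^sub>L S)" by simp
    have "T o\<^sub>L S = S o\<^sub>L T"
      unfolding T_eq by (simp add: blinfun_compose.diff_left blinfun_compose.diff_right blinfun_compose_assoc)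
    then show "S = R" using positive_sqrt_unique[of S R] R S by metis
  qed (use R in blast)
  with R(1,2) show "positive_operator (operator_sqrt (id_blinfun - T))"
    "operator_sqrt (id_blinfun - T) o\<^sub>L operator_sqrt (id_blinfun - T) = id_blinfun - T" by simp_all
qed

section \<open>Defect operators and two-sided factorisation\<close>

lemma contractionsD:
  assumes "C \<in> contractions"
  shows contractions_operators: "C \<in> operators" and contractions_norm: "norm C \<le> 1"
    and contractions_norm_apply: "norm (blinfun_apply C x) \<le> norm x"
proof -
  show *: "C \<in> operators" "norm C \<le> 1" using assms by (simp_all add: contractions_def)
  then have "norm C * norm x \<le> 1 * norm x" by (intro mult_right_mono) auto
  with norm_blinfun[of C x] show "norm (blinfun_apply C x) \<le> norm x" by simp
qed

lemma hilbert_adjoint_contraction: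
  "C \<in> contractions \<Longrightarrow> hilbert_adjoint C \<in> contractions"
  using hilbert_adjoint_operators norm_hilbert_adjoint_le order_trans
  by (fastforce simp: contractions_def)

lemma defect_operator:
  assumes C: "C \<in> contractions"
  shows positive_defect_operator: "positive_operator (defect_operator C)"
    and norm_defect_operator_sq:
      "(norm (blinfun_apply (defect_operator C) x))\<^sup>2 = (norm x)\<^sup>2 - (norm (blinfun_apply C x))\<^sup>2"
proof -
  let ?T = "hilbert_adjoint C o\<^sub>L C"
  note op = contractions_operators[OF C]
  have T: "?T \<in> operators" by (intro operators_compose hilbert_adjoint_operators op)
  have "norm ?T \<le> norm (hilbert_adjoint C) * norm C" by (rule norm_blinfun_compose)
  also have "\<dots> \<le> 1 * 1"
    by (intro mult_mono contractions_norm C hilbert_adjoint_contraction) simp_all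
  finally have norm: "norm ?T \<le> 1" by simp
  have cinner_T: "cinner y (?T x) = cinner (C y) (C x)" for x y
    by (simp add: cinner_hilbert_adjoint[OF op, symmetric])
  have sa: "self_adjoint ?T"
    unfolding self_adjoint_def cinner_T
    using cinner_T by (metis cinner_commute)
  note sqrt = operator_sqrt[OF T norm sa]
  let ?D = "operator_sqrt (id_blinfun - ?T)"
  show pos: "positive_operator (defect_operator C)"
    unfolding defect_operator_def by (rule sqrt)
  have "cinner (?D x) (?D x) = cinner x ((?D o\<^sub>L ?D) x)"
    by (simp add: self_adjointD[OF positive_operator_self_adjoint[OF sqrt(1)]])
  also have "\<dots> = cinner x x - cinner (C x) (C x)"
    unfolding sqrt(2) by (simp add: blinfun.diff_left cinner.diff_right cinner_T[simplified])
  finally show "(norm (blinfun_apply (defect_operator C) x))\<^sup>2 = (norm x)\<^sup>2 - (norm (blinfun_apply C x))\<^sup>2"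
    unfolding defect_operator_def cinner_self of_real_diff[symmetric] of_real_eq_iff .
qed

lemma clinear_cnj_cinner: "clinear (\<lambda>y. cnj (cinner x y))"
  by (simp add: clinear_def cinner.add_right cinner_scaleC_right scaleC_complex_def)

text \<open>A Douglas-type lemma, proved by two applications of the representation theorem: the first
  pulls \<open>E\<close> out of the form, with a representing vector bounded by \<open>r * norm (E' y)\<close>, so that the
  second can pull out \<open>E'\<close>.\<close>

lemma two_sided_factorization:
  fixes C :: "'a :: complex_hilbert \<Rightarrow>\<^sub>L 'b :: complex_hilbert"
    and E :: "'a \<Rightarrow>\<^sub>L 'c :: complex_hilbert"
  assumes C: "C \<in> operators" and E: "E \<in> operators" and E': "E' \<in> operators" "self_adjoint E'"
    and r: "0 \<le> r"
    and bd: "\<And>x y. cmod (cinner (blinfun_apply C x) y)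
      \<le> r * norm (blinfun_apply E x) * norm (blinfun_apply E' y)"
  obtains Q where "Q \<in> operators" "norm Q \<le> r" "C = E' o\<^sub>L Q o\<^sub>L E"
    "range (blinfun_apply Q) \<subseteq> closure (range (blinfun_apply E'))"
proof -
  have left: "clinear (\<lambda>x. cinner (C x) y)" for y
    by (simp add: clinear_def blinfun.add_right cinner.add_left operators_scaleC[OF C]
        cinner_scaleC_left scaleC_complex_def)
  have right: "clinear (\<lambda>y. cnj (cinner (C x) y))" for x by (rule clinear_cnj_cinner)
  have bd1: "cmod (cinner (C x) y) \<le> (r * norm (E' y)) * norm (E x)" for x y
    using bd[of x y] by (simp only: mult_ac)
  show ?thesis
  proof (rule sesquilinear_representation[OF operators_clinear[OF E] left right bd1])
    fix Z assume Z: "clinear Z" "\<And>y. norm (Z y) \<le> r * norm (E' y)"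
      "\<And>x y. cinner (C x) y = cinner (E x) (Z y)"
    have left': "clinear (\<lambda>y. cinner (Z y) u)" for u
      by (simp add: clinear_def clinear_add[OF Z(1)] clinear_scaleC[OF Z(1)] cinner.add_left
          cinner_scaleC_left scaleC_complex_def)
    have right': "clinear (\<lambda>u. cnj (cinner (Z y) u))" for y by (rule clinear_cnj_cinner)
    have bd2: "cmod (cinner (Z y) u) \<le> (r * norm u) * norm (E' y)" for y u
    proof -
      have "cmod (cinner (Z y) u) \<le> norm (Z y) * norm u" by (rule cinner_Cauchy_Schwarz)
      also have "\<dots> \<le> (r * norm (E' y)) * norm u" by (intro mult_right_mono Z) simp
      finally show ?thesis by (simp only: mult_ac)
    qed
    show thesis
    proof (rule sesquilinear_representation[OF operators_clinear[OF E'(1)] left' right' bd2])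
      fix W assume W: "clinear W" "\<And>u. W u \<in> closure (range E')" "\<And>u. norm (W u) \<le> r * norm u"
        "\<And>y u. cinner (Z y) u = cinner (E' y) (W u)"
      show thesis
      proof (rule clinear_Blinfun[OF W(1,3) r])
        fix Q assume Q: "Q \<in> operators" "\<And>u. blinfun_apply Q u = W u" "norm Q \<le> r"
        show thesis
        proof (rule that[OF Q(1,3)])
          show "range Q \<subseteq> closure (range E')" using W(2) by (auto simp: Q(2))
          show "C = E' o\<^sub>L Q o\<^sub>L E"
          proof (rule blinfun_eqI, rule cinner_eqI)
            fix x y
            have "cinner (C x) y = cnj (cinner (Z y) (E x))"
              unfolding Z(3) by (rule cinner_commute)
            also have "\<dots> = cinner (Q (E x)) (E' y)"
              unfolding W(4) Q(2) by (rule cinner_commute[symmetric])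
            also have "\<dots> = cinner ((E' o\<^sub>L Q o\<^sub>L E) x) y"
              by (simp add: self_adjointD[OF E'(2)])
            finally show "cinner (C x) y = cinner ((E' o\<^sub>L Q o\<^sub>L E) x) y" .
          qed
        qed
      qed
    qed (use r in simp)
  qed (use r in simp)
qed

text \<open>The form bound that characterises \<open>A \<prec>\<^sub>D B\<close>. It carries the constant explicitly, so that bounds at
  different points of the disc can be compared.\<close>

definition defect_dominated ::
    "real \<Rightarrow> ('a :: complex_hilbert \<Rightarrow>\<^sub>L 'b :: complex_hilbert) \<Rightarrow> ('a \<Rightarrow>\<^sub>L 'b) \<Rightarrow> bool"
  where "defect_dominated r A B \<longleftrightarrow> (\<forall>x y. cmod (cinner (blinfun_apply (A - B) x) y) \<le>
    r * norm (blinfun_apply (defect_operator B) x) *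
        norm (blinfun_apply (defect_operator (hilbert_adjoint B)) y))"

lemma defect_dominatedI_factor:
  assumes B: "B \<in> contractions" and r: "0 \<le> r"
    and eq: "\<And>x. blinfun_apply (A - B) x =
      blinfun_apply (defect_operator (hilbert_adjoint B)) (X (blinfun_apply (defect_operator B) x))"
    and bd: "\<And>x. norm (X (blinfun_apply (defect_operator B) x)) \<le> r * norm (blinfun_apply (defect_operator B) x)"
  shows "defect_dominated r A B"
  unfolding defect_dominated_def
proof (intro allI)
  fix x y
  let ?D = "defect_operator B" and ?D' = "defect_operator (hilbert_adjoint B)"
  have "self_adjoint ?D'"
    by (intro positive_operator_self_adjoint positive_defect_operator hilbert_adjoint_contraction B)
  then have "cinner ((A - B) x) y = cinner (X (?D x)) (?D' y)"
    unfolding eq by (rule self_adjointD)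
  also have "cmod \<dots> \<le> norm (X (?D x)) * norm (?D' y)" by (rule cinner_Cauchy_Schwarz)
  also have "\<dots> \<le> (r * norm (?D x)) * norm (?D' y)" by (intro mult_right_mono bd) simp
  finally show "cmod (cinner ((A - B) x) y) \<le> r * norm (?D x) * norm (?D' y)" .
qed

lemma defect_dominatedE_factor:
  assumes A: "A \<in> operators" and B: "B \<in> contractions" and r: "0 \<le> r"
    and dom: "defect_dominated r A B"
  obtains Q where "Q \<in> operators" "norm Q \<le> r"
    "A - B = defect_operator (hilbert_adjoint B) o\<^sub>L Q o\<^sub>L defect_operator B"
    "range (blinfun_apply Q) \<subseteq> defect_space (hilbert_adjoint B)"
proof -
  have B': "hilbert_adjoint B \<in> contractions" by (rule hilbert_adjoint_contraction[OF B])
  have op: "defect_operator B \<in> operators" "defect_operator (hilbert_adjoint B) \<in> operators"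
    using positive_defect_operator[OF B] positive_defect_operator[OF B']
    by (simp_all add: positive_operator_def)
  have sa: "self_adjoint (defect_operator (hilbert_adjoint B))"
    by (intro positive_operator_self_adjoint positive_defect_operator B')
  show ?thesis
    by (rule two_sided_factorization[OF operators_diff[OF A contractions_operators[OF B]] op sa r
          dom[unfolded defect_dominated_def, rule_format]])
      (erule (2) that, simp only: defect_space_def)
qed

lemma defect_prec_iff_dominated:
  assumes A: "A \<in> operators" and B: "B \<in> contractions"
  shows "A \<prec>\<^sub>D B \<longleftrightarrow> (\<exists>r\<ge>0. defect_dominated r A B)"
proof
  assume "A \<prec>\<^sub>D B"
  then obtain X where X: "X \<in> operators_between (defect_space B) (defect_space (hilbert_adjoint B))"
    and eq: "\<And>x. (A - B) x = defect_operator (hilbert_adjoint B) (X (defect_operator B x))"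
    unfolding defect_prec_def by blast
  from X obtain K where K: "\<And>x. x \<in> defect_space B \<Longrightarrow> norm (X x) \<le> K * norm x"
    unfolding operators_between_def by blast
  have "defect_dominated \<bar>K\<bar> A B"
  proof (rule defect_dominatedI_factor[OF B _ eq])
    fix x
    have "norm (X (defect_operator B x)) \<le> K * norm (defect_operator B x)"
      by (rule K) (auto simp: defect_space_def intro: closure_subset[THEN subsetD])
    also have "\<dots> \<le> \<bar>K\<bar> * norm (defect_operator B x)" by (intro mult_right_mono) auto
    finally show "norm (X (defect_operator B x)) \<le> \<bar>K\<bar> * norm (defect_operator B x)" .
  qed simp
  then show "\<exists>r\<ge>0. defect_dominated r A B" by (intro exI[of _ "\<bar>K\<bar>"]) simp
next
  assume "\<exists>r\<ge>0. defect_dominated r A B"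
  then obtain r where r: "0 \<le> r" "defect_dominated r A B" by blast
  obtain Q where Q: "Q \<in> operators" "norm Q \<le> r"
    "A - B = defect_operator (hilbert_adjoint B) o\<^sub>L Q o\<^sub>L defect_operator B"
    "range (blinfun_apply Q) \<subseteq> defect_space (hilbert_adjoint B)"
    by (rule defect_dominatedE_factor[OF A B r]) (rule that)
  show "A \<prec>\<^sub>D B"
    unfolding defect_prec_def
  proof (rule bexI[of _ "blinfun_apply Q"])
    have "\<exists>K. \<forall>x. norm (Q x) \<le> K * norm x" using norm_blinfun by blast
    with Q(1,4) show "blinfun_apply Q \<in> operators_between (defect_space B) (defect_space (hilbert_adjoint B))"
      unfolding operators_between_def operators_def by (auto simp: blinfun.add_right)
  qed (simp add: Q(3))
qed

section \<open>Vector-valued power series and their circle means\<close>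

lemma taylor_summable_majorant:
  fixes a :: "nat \<Rightarrow> 'a :: complex_normed_vector"
  assumes f: "taylor_on_disc f a" and \<rho>: "0 \<le> \<rho>" "\<rho> < 1"
  shows "summable (\<lambda>n. \<rho> ^ n * norm (a n))"
proof -
  define \<sigma> where "\<sigma> = (\<rho> + 1) / 2"
  have \<sigma>: "\<rho> < \<sigma>" "0 < \<sigma>" "\<sigma> < 1" using \<rho> by (auto simp: \<sigma>_def)
  have "summable (\<lambda>n. complex_of_real \<sigma> ^ n *\<^sub>C a n)"
    using f \<sigma> by (auto simp: taylor_on_disc_def intro: sums_summable)
  then have "Bseq (\<lambda>n. complex_of_real \<sigma> ^ n *\<^sub>C a n)"
    using convergentI convergent_imp_Bseq summable_LIMSEQ_zero by blast
  then obtain B where B: "\<And>n. norm (complex_of_real \<sigma> ^ n *\<^sub>C a n) \<le> B"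
    unfolding Bseq_def by blast
  show ?thesis
  proof (rule summable_comparison_test')
    show "summable (\<lambda>n. B * (\<rho> / \<sigma>) ^ n)"
      using \<rho> \<sigma> by (intro summable_mult summable_geometric) simp
    fix n
    have "\<rho> ^ n * norm (a n) = (\<rho> / \<sigma>) ^ n * norm (complex_of_real \<sigma> ^ n *\<^sub>C a n)"
      using \<sigma> by (simp add: norm_scaleC norm_power power_divide)
    also have "\<dots> \<le> (\<rho> / \<sigma>) ^ n * B"
      using \<rho> \<sigma> by (intro mult_left_mono B) simp
    finally show "norm (\<rho> ^ n * norm (a n)) \<le> B * (\<rho> / \<sigma>) ^ n"
      using \<rho> by (simp add: mult.commute)
  qed
qed

lemma taylor_uniform_limit:
  fixes a :: "nat \<Rightarrow> 'a :: complex_hilbert"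
  assumes f: "taylor_on_disc f a" and \<rho>: "0 \<le> \<rho>" "\<rho> < 1"
  shows "uniform_limit (cball 0 \<rho>) (\<lambda>N z. \<Sum>n<N. z ^ n *\<^sub>C a n) f sequentially"
proof -
  have "uniform_limit (cball 0 \<rho>) (\<lambda>N z. \<Sum>n<N. z ^ n *\<^sub>C a n) (\<lambda>z. \<Sum>n. z ^ n *\<^sub>C a n) sequentially"
  proof (rule Weierstrass_m_test)
    show "summable (\<lambda>n. \<rho> ^ n * norm (a n))" by (rule taylor_summable_majorant[OF f \<rho>])
  qed (auto simp: norm_scaleC norm_power intro!: mult_right_mono power_mono)
  also have "?this \<longleftrightarrow> ?thesis"
    using f \<rho> by (intro uniform_limit_cong' refl) (auto simp: taylor_on_disc_def sums_iff)
  finally show ?thesis .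
qed

lemma taylor_continuous_on:
  fixes a :: "nat \<Rightarrow> 'a :: complex_hilbert"
  assumes f: "taylor_on_disc f a" and \<rho>: "0 \<le> \<rho>" "\<rho> < 1"
  shows "continuous_on (cball 0 \<rho>) f"
proof (rule uniform_limit_theorem[OF _ taylor_uniform_limit[OF assms]])
  show "\<forall>\<^sub>F N in sequentially. continuous_on (cball 0 \<rho>) (\<lambda>z. \<Sum>n<N. z ^ n *\<^sub>C a n)"
    by (intro always_eventually allI continuous_intros scaleC.continuous_on)
qed simp

lemma has_integral_circle_monomial:
  fixes c :: complex and k :: int
  shows "((\<lambda>t. cos (of_int k * t) * Re c - sin (of_int k * t) * Im c)
    has_integral (if k = 0 then 2 * pi * Re c else 0)) {0..2*pi}"
proof (cases "k = 0")
  case True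
  then show ?thesis
    using has_integral_const_real[of "Re c" 0 "2 * pi"] by simp
next
  case False
  define P where "P t = (sin (of_int k * t) * Re c + cos (of_int k * t) * Im c) / of_int k" for t :: real
  have "((\<lambda>t. cos (of_int k * t) * Re c - sin (of_int k * t) * Im c)
      has_integral (P (2 * pi) - P 0)) {0..2*pi}"
  proof (rule fundamental_theorem_of_calculus)
    fix t
    show "(P has_vector_derivative cos (of_int k * t) * Re c - sin (of_int k * t) * Im c)
        (at t within {0..2*pi})"
      unfolding has_real_derivative_iff_has_vector_derivative[symmetric] P_def
      by (rule derivative_eq_intros refl | (use False in \<open>simp add: field_simps\<close>))+
  qed simp
  moreover have "P (2 * pi) = P 0"
    using sin_int_2pin[of k] cos_int_2pin[of k] by (simp add: P_def mult.commute)
  ultimately show ?thesis using False by simp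
qed

lemma inner_circle_monomials:
  fixes u v :: "'a :: complex_hilbert"
  shows "inner (rcis \<rho> t ^ n *\<^sub>C u) (rcis \<rho> t ^ m *\<^sub>C v) = \<rho> ^ (n + m) *
    (cos (of_int (int n - int m) * t) * Re (cinner u v) - sin (of_int (int n - int m) * t) * Im (cinner u v))"
proof -
  have "inner (rcis \<rho> t ^ n *\<^sub>C u) (rcis \<rho> t ^ m *\<^sub>C v)
      = Re (rcis \<rho> t ^ n * cnj (rcis \<rho> t ^ m) * cinner u v)"
    by (simp add: Re_cinner[symmetric] cinner_scaleC_left cinner_scaleC_right mult_ac)
  also have "rcis \<rho> t ^ n * cnj (rcis \<rho> t ^ m) = rcis (\<rho> ^ (n + m)) (of_int (int n - int m) * t)"
  proof -
    have "cnj (rcis \<rho> t ^ m) = rcis (\<rho> ^ m) (- (real m * t))"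
      unfolding DeMoivre2 by (simp add: rcis_def cis_cnj)
    then show ?thesis by (simp only: DeMoivre2 rcis_mult power_add) (simp add: algebra_simps)
  qed
  finally show ?thesis by (simp add: rcis_def algebra_simps)
qed

text \<open>Parseval's identity on a circle: on partial sums it is orthogonality of the monomials, and
  on the circle of radius \<open>\<rho> < 1\<close> the partial sums converge uniformly.\<close>

lemma circle_Parseval:
  fixes a b :: "nat \<Rightarrow> 'a :: complex_hilbert"
  assumes f: "taylor_on_disc f a" and g: "taylor_on_disc g b" and \<rho>: "0 \<le> \<rho>" "\<rho> < 1"
  obtains J where "((\<lambda>t. inner (f (rcis \<rho> t)) (g (rcis \<rho> t))) has_integral 2 * pi * J) {0..2*pi}"
    "(\<lambda>n. \<rho> ^ (2 * n) * inner (a n) (b n)) sums J"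
proof -
  have circle: "rcis \<rho> \<in> {0..2*pi} \<rightarrow> cball 0 \<rho>" using \<rho> by auto
  have cont: "continuous_on {0..2*pi} (rcis \<rho>)"
    unfolding rcis_def by (intro continuous_intros)
  have lim: "uniform_limit {0..2*pi} (\<lambda>N t. \<Sum>n<N. rcis \<rho> t ^ n *\<^sub>C c n) (\<lambda>t. h (rcis \<rho> t)) sequentially"
    and bdd: "bounded ((\<lambda>t. h (rcis \<rho> t)) ` {0..2*pi})" if "taylor_on_disc h c" for h and c :: "nat \<Rightarrow> 'a"
  proof -
    show "uniform_limit {0..2*pi} (\<lambda>N t. \<Sum>n<N. rcis \<rho> t ^ n *\<^sub>C c n) (\<lambda>t. h (rcis \<rho> t)) sequentially"
      by (rule uniform_limit_compose'[OF taylor_uniform_limit[OF that \<rho>] circle])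
    have "continuous_on {0..2*pi} (\<lambda>t. h (rcis \<rho> t))"
      using circle by (intro continuous_on_compose2[OF taylor_continuous_on[OF that \<rho>] cont]) auto
    then show "bounded ((\<lambda>t. h (rcis \<rho> t)) ` {0..2*pi})"
      by (intro compact_imp_bounded compact_continuous_image compact_Icc)
  qed
  define p where "p N t = inner (\<Sum>n<N. rcis \<rho> t ^ n *\<^sub>C a n) (\<Sum>n<N. rcis \<rho> t ^ n *\<^sub>C b n)" for N t
  have "uniform_limit {0..2*pi} p (\<lambda>t. inner (f (rcis \<rho> t)) (g (rcis \<rho> t))) sequentially"
    unfolding p_def
    by (intro bounded_bilinear.bounded_uniform_limit[OF bounded_bilinear_inner] lim[OF f] lim[OF g] bdd[OF f] bdd[OF g])
  moreover have "continuous_on {0..2*pi} (p N)" for N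
    unfolding p_def by (intro continuous_intros scaleC.continuous_on cont)
  ultimately obtain I J where IJ: "\<And>N. (p N has_integral I N) {0..2*pi}"
      "((\<lambda>t. inner (f (rcis \<rho> t)) (g (rcis \<rho> t))) has_integral J) {0..2*pi}" "I \<longlonglongrightarrow> J"
    by (rule uniform_limit_integral) (simp, rule that)
  have "(p N has_integral 2 * pi * (\<Sum>n<N. \<rho> ^ (2 * n) * inner (a n) (b n))) {0..2*pi}" for N
  proof -
    let ?w = "\<lambda>n m t. cos (of_int (int n - int m) * t) * Re (cinner (a n) (b m))
        - sin (of_int (int n - int m) * t) * Im (cinner (a n) (b m))"
    have "p N = (\<lambda>t. \<Sum>n<N. \<Sum>m<N. \<rho> ^ (n + m) * ?w n m t)"
      unfolding p_def inner_sum_left inner_sum_right inner_circle_monomials ..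
    moreover have "((\<lambda>t. \<Sum>n<N. \<Sum>m<N. \<rho> ^ (n + m) * ?w n m t) has_integral
        (\<Sum>n<N. \<Sum>m<N. \<rho> ^ (n + m) * (if int n - int m = 0 then 2 * pi * Re (cinner (a n) (b m)) else 0)))
        {0..2*pi}"
      by (intro has_integral_sum has_integral_mult_right has_integral_circle_monomial) auto
    moreover have "(\<Sum>m<N. \<rho> ^ (n + m) * (if int n - int m = 0 then 2 * pi * Re (cinner (a n) (b m)) else 0))
        = 2 * pi * (\<rho> ^ (2 * n) * inner (a n) (b n))" if "n < N" for n
    proof -
      have "(\<Sum>m<N. \<rho> ^ (n + m) * (if int n - int m = 0 then 2 * pi * Re (cinner (a n) (b m)) else 0))
          = (\<Sum>m<N. if m = n then 2 * pi * (\<rho> ^ (2 * n) * inner (a n) (b n)) else 0)"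
        by (intro sum.cong refl) (simp add: Re_cinner mult_2[of n])
      with that show ?thesis by simp
    qed
    ultimately show ?thesis by (simp add: sum_distrib_left)
  qed
  then have I: "I = (\<lambda>N. 2 * pi * (\<Sum>n<N. \<rho> ^ (2 * n) * inner (a n) (b n)))"
    by (intro ext has_integral_unique[OF IJ(1)])
  have "(\<lambda>N. 2 * pi * (\<Sum>n<N. \<rho> ^ (2 * n) * inner (a n) (b n)) / (2 * pi)) \<longlonglongrightarrow> J / (2 * pi)"
    using IJ(3) unfolding I by (intro tendsto_divide) auto
  then have "(\<lambda>n. \<rho> ^ (2 * n) * inner (a n) (b n)) sums (J / (2 * pi))"
    by (simp add: sums_def)
  with IJ(2) show ?thesis by (intro that[of "J / (2 * pi)"]) simp_all
qed

lemma Abel_limit_absolute: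
  fixes c :: "nat \<Rightarrow> real"
  assumes c: "summable (\<lambda>n. \<bar>c n\<bar>)"
  shows "((\<lambda>\<rho>. \<Sum>n. \<rho> ^ (2 * n) * c n) \<longlongrightarrow> (\<Sum>n. c n)) (at_left 1)"
proof -
  have "uniform_limit {0..1} (\<lambda>N \<rho>. \<Sum>n<N. \<rho> ^ (2 * n) * c n) (\<lambda>\<rho>. \<Sum>n. \<rho> ^ (2 * n) * c n) sequentially"
  proof (rule Weierstrass_m_test[OF _ c])
    fix n and \<rho> :: real assume \<rho>: "\<rho> \<in> {0..1}"
    then have "\<rho> ^ (2 * n) * \<bar>c n\<bar> \<le> 1 * \<bar>c n\<bar>"
      by (intro mult_right_mono power_le_one) auto
    with \<rho> show "norm (\<rho> ^ (2 * n) * c n) \<le> \<bar>c n\<bar>" by (simp add: abs_mult)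
  qed
  then have "continuous_on {0..1} (\<lambda>\<rho>. \<Sum>n. \<rho> ^ (2 * n) * c n)"
    by (rule uniform_limit_theorem[rotated]) (auto intro!: always_eventually continuous_intros)
  then have "((\<lambda>\<rho>. \<Sum>n. \<rho> ^ (2 * n) * c n) \<longlongrightarrow> (\<Sum>n. 1 ^ (2 * n) * c n)) (at 1 within {0..1})"
    unfolding continuous_on_def by (rule bspec) simp
  then show ?thesis by (simp add: at_within_Icc_at_left)
qed

text \<open>A substitute for the integral of boundary values over the unit circle: the limit of the means over the
  circles of radius \<open>\<rho> < 1\<close>.\<close>

definition has_boundary_mean :: "(complex \<Rightarrow> real) \<Rightarrow> real \<Rightarrow> bool"
  where "has_boundary_mean \<phi> c \<longleftrightarrow>
    (\<exists>J. (\<forall>\<rho>\<in>{0..<1}. ((\<lambda>t. \<phi> (rcis \<rho> t)) has_integral J \<rho>) {0..2*pi}) \<and>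
      (J \<longlongrightarrow> 2 * pi * c) (at_left 1))"

lemma has_boundary_mean_add:
  assumes "has_boundary_mean \<phi> c" "has_boundary_mean \<psi> d"
  shows "has_boundary_mean (\<lambda>z. \<phi> z + \<psi> z) (c + d)"
proof -
  obtain J K where J: "\<forall>\<rho>\<in>{0..<1}. ((\<lambda>t. \<phi> (rcis \<rho> t)) has_integral J \<rho>) {0..2*pi}"
      "(J \<longlongrightarrow> 2 * pi * c) (at_left 1)"
    and K: "\<forall>\<rho>\<in>{0..<1}. ((\<lambda>t. \<psi> (rcis \<rho> t)) has_integral K \<rho>) {0..2*pi}"
      "(K \<longlongrightarrow> 2 * pi * d) (at_left 1)"
    using assms unfolding has_boundary_mean_def by auto
  have "((\<lambda>\<rho>. J \<rho> + K \<rho>) \<longlongrightarrow> 2 * pi * (c + d)) (at_left 1)"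
    using tendsto_add[OF J(2) K(2)] by (simp add: distrib_left)
  with J(1) K(1) show ?thesis
    unfolding has_boundary_mean_def
    by (intro exI[of _ "\<lambda>\<rho>. J \<rho> + K \<rho>"]) (auto intro: has_integral_add)
qed

lemma has_boundary_mean_cmult:
  assumes "has_boundary_mean \<phi> c"
  shows "has_boundary_mean (\<lambda>z. r * \<phi> z) (r * c)"
proof -
  obtain J where J: "\<forall>\<rho>\<in>{0..<1}. ((\<lambda>t. \<phi> (rcis \<rho> t)) has_integral J \<rho>) {0..2*pi}"
      "(J \<longlongrightarrow> 2 * pi * c) (at_left 1)"
    using assms unfolding has_boundary_mean_def by auto
  have "((\<lambda>\<rho>. r * J \<rho>) \<longlongrightarrow> 2 * pi * (r * c)) (at_left 1)"
    using tendsto_mult_left[OF J(2), of r] by (simp add: mult_ac)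
  with J(1) show ?thesis
    unfolding has_boundary_mean_def
    by (intro exI[of _ "\<lambda>\<rho>. r * J \<rho>"]) (auto intro: has_integral_mult_right)
qed

lemma has_boundary_mean_nonneg:
  assumes \<phi>: "has_boundary_mean \<phi> c" and nonneg: "\<And>z. z \<in> \<D> \<Longrightarrow> 0 \<le> \<phi> z"
  shows "0 \<le> c"
proof -
  obtain J where J: "\<forall>\<rho>\<in>{0..<1}. ((\<lambda>t. \<phi> (rcis \<rho> t)) has_integral J \<rho>) {0..2*pi}"
      "(J \<longlongrightarrow> 2 * pi * c) (at_left 1)"
    using \<phi> unfolding has_boundary_mean_def by auto
  have "\<forall>\<^sub>F \<rho> in at_left 1. \<rho> \<in> {0<..<1::real}"
    by (rule eventually_at_leftI[of 0]) auto
  then have "\<forall>\<^sub>F \<rho> in at_left 1. 0 \<le> J \<rho>"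
  proof eventually_elim
    case (elim \<rho>)
    show ?case
      by (rule has_integral_nonneg[OF J(1)[rule_format]]) (use elim in \<open>auto intro!: nonneg\<close>)
  qed
  then have "0 \<le> 2 * pi * c"
    by (intro tendsto_lowerbound[OF J(2)]) auto
  then show ?thesis using pi_gt_zero by (simp add: zero_le_mult_iff)
qed

lemma has_boundary_mean_inner:
  "has_boundary_mean (\<lambda>z. inner (hardy_apply f z) (hardy_apply g z)) (inner f g)"
proof -
  let ?c = "\<lambda>n. inner (hardy_coeff f n) (hardy_coeff g n)"
  have int: "((\<lambda>t. inner (hardy_apply f (rcis \<rho> t)) (hardy_apply g (rcis \<rho> t))) has_integral
      2 * pi * (\<Sum>n. \<rho> ^ (2 * n) * ?c n)) {0..2*pi}" if "\<rho> \<in> {0..<1}" for \<rho>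
  proof -
    have \<rho>: "0 \<le> \<rho>" "\<rho> < 1" using that by auto
    obtain J where "((\<lambda>t. inner (hardy_apply f (rcis \<rho> t)) (hardy_apply g (rcis \<rho> t)))
        has_integral 2 * pi * J) {0..2*pi}" and sm: "(\<lambda>n. \<rho> ^ (2 * n) * ?c n) sums J"
      by (rule circle_Parseval[OF taylor_hardy_coeff taylor_hardy_coeff \<rho>]) (rule that)
    then show ?thesis by (simp only: sums_unique[OF sm, symmetric])
  qed
  have "summable (\<lambda>n. \<bar>?c n\<bar>)"
  proof (rule summable_comparison_test')
    show "summable (\<lambda>n. (norm (hardy_coeff f n))\<^sup>2 + (norm (hardy_coeff g n))\<^sup>2)"
      using square_summable_hardy_coeff[of f] square_summable_hardy_coeff[of g]
      unfolding square_summable_def by (rule summable_add)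
    fix n
    have "\<bar>?c n\<bar> \<le> norm (hardy_coeff f n) * norm (hardy_coeff g n)" by (rule Cauchy_Schwarz_ineq2)
    also have "\<dots> \<le> (norm (hardy_coeff f n))\<^sup>2 + (norm (hardy_coeff g n))\<^sup>2"
      using sum_squares_bound[of "norm (hardy_coeff f n)" "norm (hardy_coeff g n)"]
        mult_nonneg_nonneg[OF norm_ge_zero[of "hardy_coeff f n"] norm_ge_zero[of "hardy_coeff g n"]]
      by linarith
    finally show "norm \<bar>?c n\<bar> \<le> (norm (hardy_coeff f n))\<^sup>2 + (norm (hardy_coeff g n))\<^sup>2" by simp
  qed
  from tendsto_mult_left[OF Abel_limit_absolute[OF this], of "2 * pi"]
  have "((\<lambda>\<rho>. 2 * pi * (\<Sum>n. \<rho> ^ (2 * n) * ?c n)) \<longlongrightarrow> 2 * pi * inner f g) (at_left 1)"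
    by (simp add: inner_hardy_def)
  with int show ?thesis
    unfolding has_boundary_mean_def
    by (intro exI[of _ "\<lambda>\<rho>. 2 * pi * (\<Sum>n. \<rho> ^ (2 * n) * ?c n)"] conjI ballI) simp_all
qed

section \<open>Taylor series of weakly holomorphic functions\<close>

text \<open>The Taylor coefficients of the scalar functions \<open>z \<mapsto> cinner (f z) y\<close> depend antilinearly on
  \<open>y\<close> and, by Cauchy's estimates, are bounded by a multiple of \<open>norm y\<close>, so they are represented
  by vectors. The estimates on all circles make the vector series converge in norm.\<close>

lemma weakly_holomorphic_taylor:
  fixes f :: "complex \<Rightarrow> 'a :: complex_hilbert"
  assumes hol: "\<And>y. (\<lambda>z. cinner (f z) y) holomorphic_on \<D>"
    and bd: "\<And>\<rho>. 0 < \<rho> \<Longrightarrow> \<rho> < 1 \<Longrightarrow> \<exists>B. \<forall>z\<in>cball 0 \<rho>. norm (f z) \<le> B"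
  obtains a where "taylor_on_disc f a"
proof -
  define coef where "coef n y = (deriv ^^ n) (\<lambda>z. cinner (f z) y) 0 / fact n" for n y
  have coef_add: "coef n (x + y) = coef n x + coef n y" for n x y
    using higher_deriv_add[OF hol[of x] hol[of y], of 0 n]
    by (simp add: coef_def cinner.add_right add_divide_distrib)
  have coef_scaleC: "coef n (c *\<^sub>C y) = cnj c * coef n y" for n c y
    using higher_deriv_cmult[OF hol[of y], of 0 n "cnj c"]
    by (simp add: coef_def cinner_scaleC_right)
  have Cauchy: "\<exists>B\<ge>0. \<forall>n y. cmod (coef n y) \<le> B / \<rho> ^ n * norm y" if \<rho>: "0 < \<rho>" "\<rho> < 1" for \<rho>
  proof -
    obtain B where B: "\<And>z. z \<in> cball 0 \<rho> \<Longrightarrow> norm (f z) \<le> B" using bd[OF \<rho>] by blast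
    have "0 \<le> B" using order_trans[OF norm_ge_zero B[of 0]] \<rho> by simp
    moreover have "cmod (coef n y) \<le> B / \<rho> ^ n * norm y" for n y
    proof -
      have sub: "ball 0 \<rho> \<subseteq> \<D>" "cball 0 \<rho> \<subseteq> \<D>" using \<rho> by auto
      have "cmod ((deriv ^^ n) (\<lambda>z. cinner (f z) y) 0) \<le> fact n * (B * norm y) / \<rho> ^ n"
      proof (rule Cauchy_inequality[OF _ _ \<rho>(1)])
        show "(\<lambda>z. cinner (f z) y) holomorphic_on ball 0 \<rho>"
          by (rule holomorphic_on_subset[OF hol sub(1)])
        show "continuous_on (cball 0 \<rho>) (\<lambda>z. cinner (f z) y)"
          by (rule holomorphic_on_imp_continuous_on[OF holomorphic_on_subset[OF hol sub(2)]])
        fix z :: complex assume "norm (0 - z) = \<rho>"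
        then have "norm (f z) * norm y \<le> B * norm y" by (intro mult_right_mono B) auto
        with cinner_Cauchy_Schwarz[of "f z" y] show "cmod (cinner (f z) y) \<le> B * norm y" by linarith
      qed
      then show ?thesis by (simp add: coef_def norm_divide field_simps)
    qed
    ultimately show ?thesis by blast
  qed
  have "\<exists>a. \<forall>y. coef n y = cinner a y" for n
  proof -
    obtain B where B: "0 \<le> B" "\<And>y. cmod (coef n y) \<le> B / (1/2) ^ n * norm y"
      using Cauchy[of "1/2"] by auto
    \<comment> \<open>The functional is made into a sesquilinear form by a scalar argument \<open>k\<close>; the representing
      vector is then found at \<open>k = 1\<close>.\<close>
    have id: "clinear (\<lambda>x :: 'a. x)" by (simp add: clinear_def)
    have left: "clinear (\<lambda>y. cnj (coef n y) * cnj k)" for k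
      by (simp add: clinear_def coef_add coef_scaleC scaleC_complex_def distrib_right)
    have right: "clinear (\<lambda>k. cnj (cnj (coef n y) * cnj k))" for y
      by (simp add: clinear_def scaleC_complex_def algebra_simps)
    have bound: "cmod (cnj (coef n y) * cnj k) \<le> (B / (1/2) ^ n * cmod k) * norm y" for y k
      using mult_right_mono[OF B(2)[of y], of "cmod k"] by (simp add: norm_mult mult_ac)
    show ?thesis
    proof (rule sesquilinear_representation[OF id left right bound])
      fix Z assume Z: "\<And>y k. cnj (coef n y) * cnj k = cinner y (Z k)"
      have "cnj (coef n y) = cinner y (Z 1)" for y using Z[of y 1] by simp
      then have "coef n y = cinner (Z 1) y" for y
        by (subst cinner_commute) (metis complex_cnj_cnj)
      then show ?thesis by blast
    qed (use B in simp)
  qed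
  then obtain a where a: "\<And>n y. coef n y = cinner (a n) y" by metis
  have "(\<lambda>n. z ^ n *\<^sub>C a n) sums f z" if z: "z \<in> \<D>" for z
  proof -
    define \<rho> where "\<rho> = (cmod z + 1) / 2"
    have \<rho>: "cmod z < \<rho>" "0 < \<rho>" "\<rho> < 1" using z norm_ge_zero[of z] by (simp_all add: \<rho>_def add_nonneg_pos)
    obtain B where B: "0 \<le> B" "\<And>n y. cmod (coef n y) \<le> B / \<rho> ^ n * norm y"
      using Cauchy[OF \<rho>(2,3)] by blast
    have norm_a: "norm (a n) \<le> B / \<rho> ^ n" for n
    proof (cases "a n = 0")
      case False
      have "norm (a n) * norm (a n) \<le> B / \<rho> ^ n * norm (a n)"
        using B(2)[of n "a n"] by (simp add: a cinner_self norm_power power2_eq_square norm_mult)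
      then show ?thesis by (rule mult_right_le_imp_le) (use False in simp)
    qed (use B \<rho> in simp)
    have "summable (\<lambda>n. z ^ n *\<^sub>C a n)"
    proof (rule summable_comparison_test')
      show "summable (\<lambda>n. B * (cmod z / \<rho>) ^ n)"
        using \<rho> by (intro summable_mult summable_geometric) simp
      fix n
      have "norm (z ^ n *\<^sub>C a n) \<le> cmod z ^ n * (B / \<rho> ^ n)"
        unfolding norm_scaleC norm_power by (intro mult_left_mono norm_a) simp
      then show "norm (z ^ n *\<^sub>C a n) \<le> B * (cmod z / \<rho>) ^ n"
        by (simp add: power_divide mult_ac)
    qed
    then obtain s where s: "(\<lambda>n. z ^ n *\<^sub>C a n) sums s" by (auto simp: summable_def)
    have "s = f z"
    proof (rule cinner_eqI)
      fix y
      have "(\<lambda>n. cinner (z ^ n *\<^sub>C a n) y) sums cinner s y"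
        by (rule bounded_linear.sums[OF cinner.bounded_linear_left s])
      moreover have "(\<lambda>n. coef n y * (z - 0) ^ n) sums cinner (f z) y"
        unfolding coef_def using hol[of y] z by (rule holomorphic_power_series)
      ultimately show "cinner s y = cinner (f z) y"
        by (auto simp: a cinner_scaleC_left mult.commute intro: sums_unique2)
    qed
    with s show ?thesis by simp
  qed
  then show ?thesis by (intro that[of a]) (simp add: taylor_on_disc_def)
qed

section \<open>Multiplication by a Schur function\<close>

lemma Schur_classD:
  assumes "F \<in> Schur_class" and "z \<in> \<D>"
  shows Schur_class_contraction: "F z \<in> contractions"
    and Schur_class_operators: "F z \<in> operators"
    and Schur_class_norm_le: "norm (blinfun_apply (F z) x) \<le> norm x"
proof -
  show *: "F z \<in> contractions" using assms by (simp add: Schur_class_def)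
  show "F z \<in> operators" "norm (blinfun_apply (F z) x) \<le> norm x"
    by (rule contractions_operators[OF *], rule contractions_norm_apply[OF *])
qed

lemma Schur_class_weakly_holomorphic:
  assumes F: "F \<in> Schur_class"
  shows "(\<lambda>z. cinner (blinfun_apply (F z) x) y) holomorphic_on \<D>"
proof (rule holomorphic_onI)
  fix z assume "z \<in> \<D>"
  then obtain F' where F': "(F has_derivative (\<lambda>h. h *\<^sub>C F')) (at z within \<D>)"
    using F unfolding Schur_class_def vector_holomorphic_on_def by blast
  have "bounded_linear (\<lambda>A. cinner (blinfun_apply A x) y)"
    by (intro bounded_linear_compose[OF cinner.bounded_linear_left] blinfun.bounded_linear_left)
  from bounded_linear.has_derivative[OF this F']
  have "((\<lambda>z. cinner (blinfun_apply (F z) x) y) has_derivative (\<lambda>h. cinner (blinfun_apply F' x) y * h)) (at z within \<D>)"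
    by (simp add: scaleC_blinfun.rep_eq cinner_scaleC_left mult.commute)
  then show "(\<lambda>z. cinner (blinfun_apply (F z) x) y) field_differentiable (at z within \<D>)"
    unfolding field_differentiable_def has_field_derivative_def by blast
qed

text \<open>As \<open>F z\<close> is a contraction, the uniform convergence of the Taylor polynomials of \<open>h\<close> on smaller discs carries
  over to their images under \<open>F z\<close>, which are holomorphic after pairing with \<open>y\<close>.\<close>

lemma Schur_class_multiply_weakly_holomorphic:
  fixes F :: "complex \<Rightarrow> 'u :: complex_hilbert \<Rightarrow>\<^sub>L 'y :: complex_hilbert"
  assumes F: "F \<in> Schur_class" and h: "taylor_on_disc h a"
  shows "(\<lambda>z. cinner (blinfun_apply (F z) (h z)) y) holomorphic_on \<D>"
proof (rule holomorphic_uniform_sequence[OF open_ball])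
  let ?p = "\<lambda>N z. \<Sum>n<N. z ^ n *\<^sub>C a n"
  let ?q = "\<lambda>N z. \<Sum>n<N. z ^ n * cinner (F z (a n)) y"
  show "?q N holomorphic_on \<D>" for N
    by (intro holomorphic_intros Schur_class_weakly_holomorphic F)
  fix z assume z: "z \<in> \<D>"
  define \<rho> where "\<rho> = (cmod z + 1) / 2"
  have \<rho>: "cmod z < \<rho>" "0 \<le> \<rho>" "\<rho> < 1" using z norm_ge_zero[of z] by (simp_all add: \<rho>_def)
  have sub: "cball z (\<rho> - cmod z) \<subseteq> cball 0 \<rho>" "cball 0 \<rho> \<subseteq> \<D>"
    using \<rho> by (auto simp: subset_iff dist_norm) (metis add.commute add_le_cancel_left diff_add_cancel dist_norm norm_minus_commute norm_triangle_sub order_trans)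
  have "uniform_limit (cball 0 \<rho>) ?q (\<lambda>z. cinner (F z (h z)) y) sequentially"
  proof (rule uniform_limitI)
    fix e :: real assume e: "e > 0"
    then have "e / (norm y + 1) > 0" by (simp add: add_nonneg_pos)
    from uniform_limitD[OF taylor_uniform_limit[OF h \<rho>(2,3)] this]
    show "\<forall>\<^sub>F N in sequentially. \<forall>w\<in>cball 0 \<rho>. dist (?q N w) (cinner (F w (h w)) y) < e"
    proof eventually_elim
      case (elim N)
      show ?case
      proof
        fix w :: complex assume w: "w \<in> cball 0 \<rho>"
        then have wD: "w \<in> \<D>" using sub by blast
        have "?q N w = cinner (F w (?p N w)) y"
          by (simp add: blinfun.sum_right cinner.sum_left operators_scaleC[OF Schur_class_operators[OF F wD]]
              cinner_scaleC_left)
        then have "dist (?q N w) (cinner (F w (h w)) y) = cmod (cinner (F w (?p N w - h w)) y)"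
          by (simp add: dist_norm blinfun.diff_right cinner.diff_left)
        also have "\<dots> \<le> norm (F w (?p N w - h w)) * norm y" by (rule cinner_Cauchy_Schwarz)
        also have "\<dots> \<le> norm (?p N w - h w) * norm y"
          by (intro mult_right_mono Schur_class_norm_le[OF F wD]) simp
        also have "\<dots> \<le> norm (?p N w - h w) * (norm y + 1)" by (intro mult_left_mono) simp_all
        also have "\<dots> < e" using elim w by (simp add: dist_norm pos_less_divide_eq add_nonneg_pos)
        finally show "dist (?q N w) (cinner (F w (h w)) y) < e" .
      qed
    qed
  qed
  then show "\<exists>d. 0 < d \<and> cball z d \<subseteq> \<D> \<and> uniform_limit (cball z d) ?q (\<lambda>z. cinner (F z (h z)) y) sequentially"
    using sub \<rho>(1) by (intro exI[of _ "\<rho> - cmod z"]) (auto intro: uniform_limit_on_subset)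
qed

text \<open>By Parseval's identity on circles the coefficients satisfy the inequality with weights \<open>\<rho> ^ (2 * n)\<close>;
  in the partial sums \<open>\<rho>\<close> can tend to \<open>1\<close>.\<close>

lemma taylor_l2_norm_mono:
  fixes a :: "nat \<Rightarrow> 'a :: complex_hilbert" and c :: "nat \<Rightarrow> 'b :: complex_hilbert"
  assumes f: "taylor_on_disc f c" and h: "taylor_on_disc h a"
    and le: "\<And>z. z \<in> \<D> \<Longrightarrow> norm (f z) \<le> norm (h z)" and a: "square_summable a"
  shows "square_summable c" "(\<Sum>n. (norm (c n))\<^sup>2) \<le> (\<Sum>n. (norm (a n))\<^sup>2)"
proof -
  have sm: "summable (\<lambda>n. (norm (a n))\<^sup>2)" using a by (simp add: square_summable_def)
  have partial: "(\<Sum>n<N. \<rho> ^ (2 * n) * (norm (c n))\<^sup>2) \<le> (\<Sum>n. (norm (a n))\<^sup>2)"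
    if \<rho>: "0 \<le> \<rho>" "\<rho> < 1" for \<rho> N
  proof -
    obtain J where J: "((\<lambda>t. inner (f (rcis \<rho> t)) (f (rcis \<rho> t))) has_integral 2 * pi * J) {0..2*pi}"
        "(\<lambda>n. \<rho> ^ (2 * n) * inner (c n) (c n)) sums J"
      using circle_Parseval[OF f f \<rho>] .
    obtain K where K: "((\<lambda>t. inner (h (rcis \<rho> t)) (h (rcis \<rho> t))) has_integral 2 * pi * K) {0..2*pi}"
        "(\<lambda>n. \<rho> ^ (2 * n) * inner (a n) (a n)) sums K"
      using circle_Parseval[OF h h \<rho>] .
    have "2 * pi * J \<le> 2 * pi * K"
    proof (rule has_integral_le[OF J(1) K(1)])
      fix t
      have "norm (f (rcis \<rho> t)) \<le> norm (h (rcis \<rho> t))" using \<rho> by (intro le) simp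
      then show "inner (f (rcis \<rho> t)) (f (rcis \<rho> t)) \<le> inner (h (rcis \<rho> t)) (h (rcis \<rho> t))"
        by (simp add: dot_square_norm power_mono)
    qed
    then have JK: "J \<le> K" by simp
    have "(\<Sum>n<N. \<rho> ^ (2 * n) * (norm (c n))\<^sup>2) \<le> J"
      using J(2) \<rho> unfolding dot_square_norm
      by (intro order_trans[OF sum_le_suminf[OF sums_summable[OF J(2)[unfolded dot_square_norm]]]])
        (auto simp: sums_iff)
    also note JK
    also have "K \<le> (\<Sum>n. (norm (a n))\<^sup>2)"
    proof (rule sums_le[OF _ K(2) summable_sums[OF sm]])
      fix n
      show "\<rho> ^ (2 * n) * inner (a n) (a n) \<le> (norm (a n))\<^sup>2"
        unfolding dot_square_norm using \<rho> by (intro mult_left_le_one_le power_le_one) auto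
    qed
    finally show ?thesis .
  qed
  have partial1: "(\<Sum>n<N. (norm (c n))\<^sup>2) \<le> (\<Sum>n. (norm (a n))\<^sup>2)" for N
  proof -
    have "((\<lambda>\<rho>. \<Sum>n<N. \<rho> ^ (2 * n) * (norm (c n))\<^sup>2) \<longlongrightarrow> (\<Sum>n<N. 1 ^ (2 * n) * (norm (c n))\<^sup>2)) (at_left (1::real))"
      by (intro tendsto_intros)
    moreover have "\<forall>\<^sub>F \<rho> in at_left (1::real). (\<Sum>n<N. \<rho> ^ (2 * n) * (norm (c n))\<^sup>2) \<le> (\<Sum>n. (norm (a n))\<^sup>2)"
      by (rule eventually_at_leftI[of 0]) (auto intro!: partial)
    ultimately show ?thesis
      by (auto intro: tendsto_upperbound)
  qed
  show "square_summable c"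
    unfolding square_summable_def
    by (rule bounded_imp_summable[of _ "\<Sum>n. (norm (a n))\<^sup>2"])
       (use partial1 in \<open>auto simp: lessThan_Suc_atMost[symmetric] simp del: sum.lessThan_Suc\<close>)
  then show "(\<Sum>n. (norm (c n))\<^sup>2) \<le> (\<Sum>n. (norm (a n))\<^sup>2)"
    by (intro suminf_le_const partial1) (simp add: square_summable_def)
qed

lemma hardy_eqI: "(\<And>z. z \<in> \<D> \<Longrightarrow> hardy_apply f z = hardy_apply g z) \<Longrightarrow> f = g"
  using hardy_apply[of f] hardy_apply[of g]
  by (auto simp: hardy_apply_inject[symmetric] fun_eq_iff) metis

lemma ex_multiplication:
  fixes F :: "complex \<Rightarrow> 'u :: complex_hilbert \<Rightarrow>\<^sub>L 'y :: complex_hilbert"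
  assumes F: "F \<in> Schur_class"
  obtains g where "\<And>z. z \<in> \<D> \<Longrightarrow> hardy_apply g z = blinfun_apply (F z) (hardy_apply h z)"
    "norm g \<le> norm h"
proof -
  define f where "f z = (if z \<in> \<D> then F z (hardy_apply h z) else 0)" for z
  have "\<exists>a. taylor_on_disc (\<lambda>z. F z (hardy_apply h z)) a"
  proof (rule weakly_holomorphic_taylor)
    show "(\<lambda>z. cinner (F z (hardy_apply h z)) y) holomorphic_on \<D>" for y
      by (rule Schur_class_multiply_weakly_holomorphic[OF F taylor_hardy_coeff])
    fix \<rho> :: real assume \<rho>: "0 < \<rho>" "\<rho> < 1"
    have "bounded (hardy_apply h ` cball 0 \<rho>)"
      using \<rho> by (intro compact_imp_bounded compact_continuous_image taylor_continuous_on[OF taylor_hardy_coeff]) auto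
    then obtain B where B: "\<And>z. z \<in> cball 0 \<rho> \<Longrightarrow> norm (hardy_apply h z) \<le> B"
      unfolding bounded_iff by blast
    have "norm (F z (hardy_apply h z)) \<le> B" if "z \<in> cball 0 \<rho>" for z
      using B[OF that] Schur_class_norm_le[OF F, of z "hardy_apply h z"] that \<rho> by auto
    then show "\<exists>B. \<forall>z\<in>cball 0 \<rho>. norm (F z (hardy_apply h z)) \<le> B" by blast
  qed blast
  then obtain a where "taylor_on_disc (\<lambda>z. F z (hardy_apply h z)) a" by blast
  then have a: "taylor_on_disc f a" by (simp add: taylor_on_disc_def f_def)
  have le: "norm (f z) \<le> norm (hardy_apply h z)" if "z \<in> \<D>" for z
    using that Schur_class_norm_le[OF F that] by (simp add: f_def)
  note mean = taylor_l2_norm_mono[OF a taylor_hardy_coeff le square_summable_hardy_coeff]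
  have f: "hardy_apply (Abs_hardy f) = f"
    using mean(1) a by (intro Abs_hardy_inverse) (auto simp: f_def)
  have "hardy_coeff (Abs_hardy f) = a" using a f by (intro hardy_coeff_eqI) simp
  then have "(norm (Abs_hardy f))\<^sup>2 \<le> (norm h)\<^sup>2" using mean(2) by (simp add: norm_hardy_sq)
  then have "norm (Abs_hardy f) \<le> norm h" by (rule power2_le_imp_le) simp
  with f show ?thesis by (intro that[of "Abs_hardy f"]) (simp_all add: f_def)
qed

lemma multiplication_operator:
  fixes F :: "complex \<Rightarrow> 'u :: complex_hilbert \<Rightarrow>\<^sub>L 'y :: complex_hilbert"
  assumes F: "F \<in> Schur_class"
  shows multiplication_operator_apply: "z \<in> \<D> \<Longrightarrow>
      hardy_apply (blinfun_apply (multiplication_operator F) h) z = blinfun_apply (F z) (hardy_apply h z)"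
    and multiplication_operator_contraction: "multiplication_operator F \<in> contractions"
proof -
  have "\<exists>M. \<forall>h. (\<forall>z\<in>\<D>. hardy_apply (M h) z = blinfun_apply (F z) (hardy_apply h z)) \<and> norm (M h) \<le> norm h"
    by (intro choice allI) (rule ex_multiplication[OF F], blast)
  then obtain M where M: "\<And>h z. z \<in> \<D> \<Longrightarrow> hardy_apply (M h) z = blinfun_apply (F z) (hardy_apply h z)"
    "\<And>h. norm (M h) \<le> norm h" by blast
  have lin: "clinear M"
    unfolding clinear_def
  proof (intro conjI allI)
    show "M (g + h) = M g + M h" for g h
      by (rule hardy_eqI) (simp add: M plus_hardy.rep_eq blinfun.add_right)
    show "M (c *\<^sub>C h) = c *\<^sub>C M h" for c h
      by (rule hardy_eqI) (simp add: M scaleC_hardy.rep_eq operators_scaleC[OF Schur_class_operators[OF F]])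
  qed
  obtain T where T: "T \<in> operators" "\<And>h. blinfun_apply T h = M h" "norm T \<le> 1"
    by (rule clinear_Blinfun[OF lin, of 1]) (use M(2) that in auto)
  have "multiplication_operator F = T"
    unfolding multiplication_operator_def
  proof (rule the_equality)
    fix S :: "'u hardy \<Rightarrow>\<^sub>L 'y hardy"
    assume "\<forall>h. \<forall>z\<in>\<D>. hardy_apply (blinfun_apply S h) z = blinfun_apply (F z) (hardy_apply h z)"
    then show "S = T" by (intro blinfun_eqI hardy_eqI) (simp add: T(2) M(1))
  qed (simp add: T(2) M(1))
  with T M(1) show "multiplication_operator F \<in> contractions"
    and "z \<in> \<D> \<Longrightarrow> hardy_apply (blinfun_apply (multiplication_operator F) h) z = blinfun_apply (F z) (hardy_apply h z)"
    by (simp_all add: contractions_def)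
qed

section \<open>From operators to points: reproducing kernels\<close>

text \<open>The function \<open>z \<mapsto> u / (1 - cnj w * z)\<close>, which reproduces values at \<open>w\<close>.\<close>

definition Szego_kernel :: "complex \<Rightarrow> 'a :: complex_hilbert \<Rightarrow> 'a hardy"
  where "Szego_kernel w u = (THE k. hardy_coeff k = (\<lambda>n. cnj w ^ n *\<^sub>C u))"

lemma hardy_coeff_Szego_kernel:
  assumes w: "w \<in> \<D>"
  shows "hardy_coeff (Szego_kernel w u) = (\<lambda>n. cnj w ^ n *\<^sub>C u)"
proof -
  have "(cmod w)\<^sup>2 < 1" using w by (simp add: power_less_one_iff abs_square_less_1)
  then have "summable (\<lambda>n. ((cmod w)\<^sup>2) ^ n * (norm u)\<^sup>2)"
    by (intro summable_mult2 summable_geometric) simp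
  then have "square_summable (\<lambda>n. cnj w ^ n *\<^sub>C u)"
    by (simp add: square_summable_def norm_scaleC norm_power power_mult_distrib power_mult[symmetric] mult.commute)
  then obtain k where k: "hardy_coeff k = (\<lambda>n. cnj w ^ n *\<^sub>C u)" by (rule hardy_coeff_surj)
  show ?thesis
    unfolding Szego_kernel_def by (rule theI[of "\<lambda>k. hardy_coeff k = (\<lambda>n. cnj w ^ n *\<^sub>C u)", OF k])
      (rule hardy_coeff_inject, simp add: k)
qed

lemma cinner_Szego_kernel:
  assumes w: "w \<in> \<D>"
  shows "cinner f (Szego_kernel w u) = cinner (hardy_apply f w) u"
proof -
  have "(\<lambda>n. w ^ n *\<^sub>C hardy_coeff f n) sums hardy_apply f w"
    using taylor_hardy_coeff[of f] w by (simp add: taylor_on_disc_def)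
  from bounded_linear.sums[OF cinner.bounded_linear_left this, of u]
  show ?thesis
    by (simp add: cinner_hardy_def hardy_coeff_Szego_kernel[OF w] cinner_scaleC_left
        cinner_scaleC_right sums_iff)
qed

lemma Szego_kernel_diagonal:
  assumes w: "w \<in> \<D>"
  shows "hardy_apply (Szego_kernel w u) w = (1 / (1 - (cmod w)\<^sup>2)) *\<^sub>R u"
proof -
  have lt: "(cmod w)\<^sup>2 < 1" using w by (simp add: power_less_one_iff abs_square_less_1)
  have "w ^ n *\<^sub>C cnj w ^ n *\<^sub>C u = ((cmod w)\<^sup>2) ^ n *\<^sub>R u" for n
    by (simp only: scaleR_scaleC scaleC_scaleC power_mult_distrib[symmetric]
        complex_norm_square[symmetric] of_real_power[symmetric])
  moreover have "(\<lambda>n. w ^ n *\<^sub>C cnj w ^ n *\<^sub>C u) sums hardy_apply (Szego_kernel w u) w"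
    using taylor_hardy_coeff[of "Szego_kernel w u"] w
    unfolding taylor_on_disc_def hardy_coeff_Szego_kernel[OF w] by blast
  ultimately have "(\<lambda>n. ((cmod w)\<^sup>2) ^ n *\<^sub>R u) sums hardy_apply (Szego_kernel w u) w"
    by (simp only:)
  moreover have "(\<lambda>n. ((cmod w)\<^sup>2) ^ n *\<^sub>R u) sums ((1 / (1 - (cmod w)\<^sup>2)) *\<^sub>R u)"
    using lt by (intro bounded_linear.sums[OF bounded_linear_scaleR_left] geometric_sums) simp
  ultimately show ?thesis by (rule sums_unique2)
qed

lemma norm_Szego_kernel_sq:
  assumes w: "w \<in> \<D>"
  shows "(norm (Szego_kernel w u))\<^sup>2 = (1 / (1 - (cmod w)\<^sup>2)) * (norm u)\<^sup>2"
proof -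
  have "(norm (Szego_kernel w u))\<^sup>2 = Re (cinner (Szego_kernel w u) (Szego_kernel w u))"
    by (simp add: cinner_self)
  also have "\<dots> = (1 / (1 - (cmod w)\<^sup>2)) * (norm u)\<^sup>2"
    unfolding cinner_Szego_kernel[OF w] Szego_kernel_diagonal[OF w]
    by (simp add: Re_cinner dot_square_norm)
  finally show ?thesis .
qed

lemma cinner_eqI_right: "(\<And>x. cinner x y = cinner x y') \<Longrightarrow> y = y'"
  by (rule cinner_eqI) (simp only: cinner_commute[of y] cinner_commute[of y'])

lemma adjoint_multiplication_Szego_kernel:
  assumes G: "G \<in> Schur_class" and w: "w \<in> \<D>"
  shows "blinfun_apply (hilbert_adjoint (multiplication_operator G)) (Szego_kernel w y)
    = Szego_kernel w (blinfun_apply (hilbert_adjoint (G w)) y)"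
proof (rule cinner_eqI_right)
  fix f
  note T = contractions_operators[OF multiplication_operator_contraction[OF G]]
  show "cinner f (hilbert_adjoint (multiplication_operator G) (Szego_kernel w y))
      = cinner f (Szego_kernel w (hilbert_adjoint (G w) y))"
    by (simp add: cinner_hilbert_adjoint[OF T, symmetric] cinner_Szego_kernel[OF w]
        multiplication_operator_apply[OF G w]
        cinner_hilbert_adjoint[OF Schur_class_operators[OF G w], symmetric])
qed

text \<open>The adjoint maps kernels to kernels; multiplication by \<open>G\<close> itself in general does not. But the kernel with value
  \<open>G w u\<close> is the orthogonal projection of the image onto the kernel functions at \<open>w\<close>, so its norm is at most that of the
  image. This is the direction that the bound of the defects needs.\<close>

lemma multiplication_Szego_kernel_norm:
  assumes G: "G \<in> Schur_class" and w: "w \<in> \<D>"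
  shows "(norm (Szego_kernel w (blinfun_apply (G w) u)))\<^sup>2
    \<le> (norm (blinfun_apply (multiplication_operator G) (Szego_kernel w u)))\<^sup>2"
proof -
  let ?v = "blinfun_apply (G w) u" and ?T = "multiplication_operator G"
  have "inner (?T (Szego_kernel w u)) (Szego_kernel w ?v) = (1 / (1 - (cmod w)\<^sup>2)) * (norm ?v)\<^sup>2"
    unfolding Re_cinner[symmetric] cinner_Szego_kernel[OF w] multiplication_operator_apply[OF G w]
      Szego_kernel_diagonal[OF w]
    by (simp add: blinfun.scaleR_right Re_cinner dot_square_norm)
  then show ?thesis
    using norm_diff_sq[of "?T (Szego_kernel w u)" "Szego_kernel w ?v"]
      zero_le_power2[of "norm (?T (Szego_kernel w u) - Szego_kernel w ?v)"]
    unfolding norm_Szego_kernel_sq[OF w] by linarith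
qed

lemma defect_dominated_at_point:
  fixes F G :: "complex \<Rightarrow> 'u :: complex_hilbert \<Rightarrow>\<^sub>L 'y :: complex_hilbert"
  assumes F: "F \<in> Schur_class" and G: "G \<in> Schur_class" and w: "w \<in> \<D>" and r: "0 \<le> r"
    and dom: "defect_dominated r (multiplication_operator F) (multiplication_operator G)"
  shows "defect_dominated r (F w) (G w)"
  unfolding defect_dominated_def
proof (intro allI)
  fix u :: 'u and y :: 'y
  let ?S = "multiplication_operator F" and ?T = "multiplication_operator G"
  note T = multiplication_operator_contraction[OF G]
  note Gw = Schur_class_contraction[OF G w]
  define s where "s = 1 / (1 - (cmod w)\<^sup>2)"
  have "(cmod w)\<^sup>2 < 1" using w by (simp add: power_less_one_iff abs_square_less_1)
  then have s: "0 < s" by (simp add: s_def)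
  let ?k = "Szego_kernel w u" and ?l = "Szego_kernel w y"
  note norm_kernel = norm_Szego_kernel_sq[OF w, folded s_def]
  have "(norm (defect_operator ?T ?k))\<^sup>2 \<le> (sqrt s * norm (defect_operator (G w) u))\<^sup>2"
    using multiplication_Szego_kernel_norm[OF G w, of u] s
    unfolding norm_defect_operator_sq[OF T] power_mult_distrib norm_defect_operator_sq[OF Gw] norm_kernel
    by (simp add: right_diff_distrib)
  then have D: "norm (defect_operator ?T ?k) \<le> sqrt s * norm (defect_operator (G w) u)"
    by (rule power2_le_imp_le) (use s in simp)
  have "(norm (defect_operator (hilbert_adjoint ?T) ?l))\<^sup>2
      = (sqrt s * norm (defect_operator (hilbert_adjoint (G w)) y))\<^sup>2"
    unfolding norm_defect_operator_sq[OF hilbert_adjoint_contraction[OF T]] power_mult_distrib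
      norm_defect_operator_sq[OF hilbert_adjoint_contraction[OF Gw]]
      adjoint_multiplication_Szego_kernel[OF G w] norm_kernel
    using s by (simp add: right_diff_distrib)
  then have D': "norm (defect_operator (hilbert_adjoint ?T) ?l)
      = sqrt s * norm (defect_operator (hilbert_adjoint (G w)) y)"
    by (rule power2_eq_imp_eq) (use s in simp_all)
  have "cinner ((?S - ?T) ?k) ?l = cinner ((F w - G w) (s *\<^sub>R u)) y"
    by (simp add: cinner_Szego_kernel[OF w] blinfun.diff_left minus_hardy.rep_eq
        multiplication_operator_apply[OF F w] multiplication_operator_apply[OF G w]
        Szego_kernel_diagonal[OF w] s_def)
  then have "s * cmod (cinner ((F w - G w) u) y) = cmod (cinner ((?S - ?T) ?k) ?l)"
    using s by (simp add: blinfun.scaleR_right cinner.scaleR_left)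
  also have "\<dots> \<le> r * norm (defect_operator ?T ?k) * norm (defect_operator (hilbert_adjoint ?T) ?l)"
    using dom unfolding defect_dominated_def by blast
  also have "\<dots> \<le> r * (sqrt s * norm (defect_operator (G w) u)) *
      (sqrt s * norm (defect_operator (hilbert_adjoint (G w)) y))"
    unfolding D' using s r by (intro mult_right_mono mult_left_mono D) auto
  also have "\<dots> = s * (r * norm (defect_operator (G w) u) * norm (defect_operator (hilbert_adjoint (G w)) y))"
    using s by (simp add: mult_ac flip: real_sqrt_mult)
  finally show "cmod (cinner ((F w - G w) u) y)
      \<le> r * norm (defect_operator (G w) u) * norm (defect_operator (hilbert_adjoint (G w)) y)"
    using s by simp
qed

section \<open>From points to operators: averaging over circles\<close>

text \<open>The optimal choice is \<open>t = q / p\<close>; enlarging \<open>p\<close> and \<open>q\<close> by \<open>e > 0\<close> makes it available if one of them is zero.\<close>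

lemma AM_GM_optimize:
  fixes x p q r :: real
  assumes le: "\<And>t. 0 < t \<Longrightarrow> 2 * x \<le> r * (t * p\<^sup>2 + q\<^sup>2 / t)"
    and p: "0 \<le> p" and q: "0 \<le> q" and r: "0 \<le> r"
  shows "x \<le> r * p * q"
proof -
  have bound: "x \<le> r * (p + e) * (q + e)" if e: "0 < e" for e
  proof -
    define t where "t = (q + e) / (p + e)"
    have t: "0 < t" using p q e by (simp add: t_def)
    have "2 * x \<le> r * (t * p\<^sup>2 + q\<^sup>2 / t)" by (rule le[OF t])
    also have "\<dots> \<le> r * (t * (p + e)\<^sup>2 + (q + e)\<^sup>2 / t)"
      using p q e r t by (intro mult_left_mono add_mono divide_right_mono power_mono) auto
    also have "\<dots> = 2 * (r * (p + e) * (q + e))"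
      using p q e by (simp add: t_def power2_eq_square)
    finally show ?thesis by simp
  qed
  have "((\<lambda>e. r * (p + e) * (q + e)) \<longlongrightarrow> r * (p + 0) * (q + 0)) (at_right 0)"
    by (intro tendsto_intros)
  moreover have "\<forall>\<^sub>F e in at_right 0. x \<le> r * (p + e) * (q + e)"
    by (rule eventually_at_rightI[of 0 1]) (auto intro: bound)
  ultimately show ?thesis by (auto intro: tendsto_lowerbound)
qed

text \<open>The pointwise bound is weakened to one between inner products of Hardy space functions, which can be averaged
  over circles.\<close>

lemma defect_dominated_multiplication:
  fixes F G :: "complex \<Rightarrow> 'u :: complex_hilbert \<Rightarrow>\<^sub>L 'y :: complex_hilbert"
  assumes F: "F \<in> Schur_class" and G: "G \<in> Schur_class" and r: "0 \<le> r"
    and dom: "\<And>z. z \<in> \<D> \<Longrightarrow> defect_dominated r (F z) (G z)"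
  shows "defect_dominated r (multiplication_operator F) (multiplication_operator G)"
  unfolding defect_dominated_def
proof (intro allI)
  fix h g
  let ?S = "multiplication_operator F" and ?T = "multiplication_operator G"
  note T = multiplication_operator_contraction[OF G]
  have D_op: "defect_operator ?T \<in> operators"
    using positive_defect_operator[OF T] by (simp add: positive_operator_def)
  let ?p = "norm (defect_operator ?T h)" and ?q = "norm (defect_operator (hilbert_adjoint ?T) g)"
  have averaged: "2 * inner ((?S - ?T) f) g \<le> r * (t * (norm (defect_operator ?T f))\<^sup>2 + ?q\<^sup>2 / t)"
    if t: "0 < t" for f t
  proof -
    \<comment> \<open>Any Hardy space function in place of \<open>h1\<close> gives an upper bound for the defect of the adjoint; this one
      makes it sharp after averaging.\<close>
    define h1 where "h1 = hilbert_adjoint ?T g"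
    let ?e = "hardy_apply"
    let ?c = "r * (t * inner f f + (- t) * inner (?T f) (?T f)
        + ((1/t) * inner g g + ((- 2 / t) * inner (?T h1) g + (1/t) * inner h1 h1)))
        + (- 2) * inner ((?S - ?T) f) g"
    have "0 \<le> ?c"
    proof (rule has_boundary_mean_nonneg)
      show "has_boundary_mean (\<lambda>z. r * (t * inner (?e f z) (?e f z) + (- t) * inner (?e (?T f) z) (?e (?T f) z)
          + ((1/t) * inner (?e g z) (?e g z) + ((- 2 / t) * inner (?e (?T h1) z) (?e g z)
          + (1/t) * inner (?e h1 z) (?e h1 z))))
          + (- 2) * inner (?e ((?S - ?T) f) z) (?e g z)) ?c"
        by (intro has_boundary_mean_add has_boundary_mean_cmult has_boundary_mean_inner)
      fix z assume z: "z \<in> \<D>"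
      note Gz = Schur_class_contraction[OF G z]
      let ?u = "?e f z" and ?y = "?e g z" and ?x = "?e h1 z"
      let ?d = "norm (defect_operator (G z) ?u)" and ?d' = "norm (defect_operator (hilbert_adjoint (G z)) ?y)"
      have "2 * inner ((F z - G z) ?u) ?y \<le> 2 * (r * ?d * ?d')"
        using dom[OF z] complex_Re_le_cmod[of "cinner ((F z - G z) ?u) ?y"]
        unfolding defect_dominated_def Re_cinner by (meson mult_left_mono order_trans zero_le_numeral)
      also have "\<dots> \<le> r * (t * ?d\<^sup>2 + ?d'\<^sup>2 / t)"
      proof -
        have "0 \<le> (t * ?d - ?d')\<^sup>2 / t" using t by simp
        also have "\<dots> = t * ?d\<^sup>2 + ?d'\<^sup>2 / t - 2 * (?d * ?d')"
          using t by (simp add: power2_eq_square field_simps)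
        finally have "2 * (?d * ?d') \<le> t * ?d\<^sup>2 + ?d'\<^sup>2 / t" by simp
        from mult_left_mono[OF this r] show ?thesis by (simp add: mult_ac)
      qed
      \<comment> \<open>Expand the square of the norm of \<open>h1 z - hilbert_adjoint (G z) (g z)\<close>.\<close>
      also have "\<dots> \<le> r * (t * ?d\<^sup>2 + ((norm ?y)\<^sup>2 - 2 * inner (G z ?x) ?y + (norm ?x)\<^sup>2) / t)"
      proof -
        have "inner (G z ?x) ?y = inner ?x (hilbert_adjoint (G z) ?y)"
          by (simp add: Re_cinner[symmetric] cinner_hilbert_adjoint[OF contractions_operators[OF Gz]])
        then have "?d'\<^sup>2 \<le> (norm ?y)\<^sup>2 - 2 * inner (G z ?x) ?y + (norm ?x)\<^sup>2"
          using norm_diff_sq[of ?x "hilbert_adjoint (G z) ?y"]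
            zero_le_power2[of "norm (?x - hilbert_adjoint (G z) ?y)"]
          unfolding norm_defect_operator_sq[OF hilbert_adjoint_contraction[OF Gz]] by linarith
        then show ?thesis using r t by (intro mult_left_mono add_left_mono divide_right_mono) auto
      qed
      finally show "0 \<le> r * (t * inner ?u ?u + (- t) * inner (?e (?T f) z) (?e (?T f) z)
          + ((1/t) * inner ?y ?y + ((- 2 / t) * inner (?e (?T h1) z) ?y + (1/t) * inner ?x ?x)))
          + (- 2) * inner (?e ((?S - ?T) f) z) ?y"
        unfolding norm_defect_operator_sq[OF Gz]
        by (simp add: dot_square_norm blinfun.diff_left minus_hardy.rep_eq
            multiplication_operator_apply[OF F z] multiplication_operator_apply[OF G z]
            algebra_simps diff_divide_distrib add_divide_distrib)
    qed
    moreover have "inner (?T h1) g = (norm h1)\<^sup>2"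
      by (simp add: Re_cinner[symmetric] cinner_hilbert_adjoint[OF contractions_operators[OF T]]
          h1_def[symmetric] cinner_self)
    moreover have q: "?q\<^sup>2 = (norm g)\<^sup>2 - (norm h1)\<^sup>2"
      unfolding h1_def by (rule norm_defect_operator_sq[OF hilbert_adjoint_contraction[OF T]])
    ultimately show ?thesis
      unfolding norm_defect_operator_sq[OF T] q
      by (simp add: dot_square_norm algebra_simps diff_divide_distrib)
  qed
  have real_part: "inner ((?S - ?T) f) g \<le> r * norm (defect_operator ?T f) * ?q" for f
    by (rule AM_GM_optimize) (use averaged r in auto)
  show "cmod (cinner ((?S - ?T) h) g) \<le> r * ?p * ?q"
  proof (cases "cinner ((?S - ?T) h) g = 0")
    case True
    then show ?thesis using r by simp
  next
    case False
    let ?i = "cinner ((?S - ?T) h) g"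
    \<comment> \<open>Rotating \<open>h\<close> by the phase \<open>c\<close> turns the modulus into a real part and preserves the norms.\<close>
    define c where "c = cnj ?i / complex_of_real (cmod ?i)"
    have c: "cmod c = 1" using False by (simp add: c_def norm_divide)
    have ci: "c * ?i = complex_of_real (cmod ?i)"
      using False complex_norm_square[of ?i] by (simp add: c_def field_simps power2_eq_square)
    have "?S - ?T \<in> operators"
      by (intro operators_diff contractions_operators multiplication_operator_contraction F G)
    then have "cmod ?i = inner ((?S - ?T) (c *\<^sub>C h)) g"
      by (simp add: operators_scaleC Re_cinner[symmetric] cinner_scaleC_left ci)
    also have "\<dots> \<le> r * norm (defect_operator ?T (c *\<^sub>C h)) * ?q" by (rule real_part)
    also have "norm (defect_operator ?T (c *\<^sub>C h)) = ?p"
      by (simp add: operators_scaleC[OF D_op] norm_scaleC c)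
    finally show ?thesis .
  qed
qed

theorem theorem0p2:
  fixes F G :: "complex \<Rightarrow> 'u :: complex_hilbert \<Rightarrow>\<^sub>L 'y :: complex_hilbert"
  assumes "separable_space (euclidean :: 'u topology)"
    and "separable_space (euclidean :: 'y topology)"
    and "F \<in> Schur_class" and "G \<in> Schur_class"
  shows "multiplication_operator F \<prec>\<^sub>D multiplication_operator G \<longleftrightarrow>
    (\<exists>Q :: complex \<Rightarrow> 'u \<Rightarrow>\<^sub>L 'y.
      (\<forall>z\<in>\<D>. Q z \<in> operators) \<and>
      bounded (Q ` \<D>) \<and>
      (\<forall>z\<in>\<D>. F z - G z =
        defect_operator (hilbert_adjoint (G z)) o\<^sub>L Q z o\<^sub>L defect_operator (G z)))"
proof -
  note F = \<open>F \<in> Schur_class\<close> and G = \<open>G \<in> Schur_class\<close>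
  have "multiplication_operator F \<prec>\<^sub>D multiplication_operator G \<longleftrightarrow>
      (\<exists>r\<ge>0. defect_dominated r (multiplication_operator F) (multiplication_operator G))"
    by (intro defect_prec_iff_dominated contractions_operators multiplication_operator_contraction F G)
  also have "\<dots> \<longleftrightarrow> (\<exists>r\<ge>0. \<forall>z\<in>\<D>. defect_dominated r (F z) (G z))"
    using defect_dominated_at_point[OF F G] defect_dominated_multiplication[OF F G] by blast
  also have "\<dots> \<longleftrightarrow> (\<exists>Q :: complex \<Rightarrow> 'u \<Rightarrow>\<^sub>L 'y.
      (\<forall>z\<in>\<D>. Q z \<in> operators) \<and> bounded (Q ` \<D>) \<and>
      (\<forall>z\<in>\<D>. F z - G z =
        defect_operator (hilbert_adjoint (G z)) o\<^sub>L Q z o\<^sub>L defect_operator (G z)))"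
  proof
    assume "\<exists>r\<ge>0. \<forall>z\<in>\<D>. defect_dominated r (F z) (G z)"
    then obtain r where r: "0 \<le> r" "\<And>z. z \<in> \<D> \<Longrightarrow> defect_dominated r (F z) (G z)" by blast
    have "\<exists>Q. Q \<in> operators \<and> norm Q \<le> r \<and>
        F z - G z = defect_operator (hilbert_adjoint (G z)) o\<^sub>L Q o\<^sub>L defect_operator (G z)"
      if z: "z \<in> \<D>" for z
      by (rule defect_dominatedE_factor[OF Schur_class_operators[OF F z]
            Schur_class_contraction[OF G z] r(1) r(2)[OF z]]) blast
    then obtain Q where Q: "\<And>z. z \<in> \<D> \<Longrightarrow> Q z \<in> operators \<and> norm (Q z) \<le> r \<and>
        F z - G z = defect_operator (hilbert_adjoint (G z)) o\<^sub>L Q z o\<^sub>L defect_operator (G z)"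
      by metis
    then have "bounded (Q ` \<D>)" unfolding bounded_iff by blast
    with Q show "\<exists>Q. (\<forall>z\<in>\<D>. Q z \<in> operators) \<and> bounded (Q ` \<D>) \<and>
      (\<forall>z\<in>\<D>. F z - G z =
        defect_operator (hilbert_adjoint (G z)) o\<^sub>L Q z o\<^sub>L defect_operator (G z))"
      by blast
  next
    assume "\<exists>Q :: complex \<Rightarrow> 'u \<Rightarrow>\<^sub>L 'y. (\<forall>z\<in>\<D>. Q z \<in> operators) \<and> bounded (Q ` \<D>) \<and>
      (\<forall>z\<in>\<D>. F z - G z =
        defect_operator (hilbert_adjoint (G z)) o\<^sub>L Q z o\<^sub>L defect_operator (G z))"
    then obtain Q :: "complex \<Rightarrow> 'u \<Rightarrow>\<^sub>L 'y" where bdd: "bounded (Q ` \<D>)" and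
      eq: "\<And>z. z \<in> \<D> \<Longrightarrow> F z - G z =
        defect_operator (hilbert_adjoint (G z)) o\<^sub>L Q z o\<^sub>L defect_operator (G z)" by blast
    obtain r where r: "0 < r" "\<And>z. z \<in> \<D> \<Longrightarrow> norm (Q z) \<le> r"
      using bdd unfolding bounded_pos by blast
    have "defect_dominated r (F z) (G z)" if z: "z \<in> \<D>" for z
    proof (rule defect_dominatedI_factor[OF Schur_class_contraction[OF G z], where X = "blinfun_apply (Q z)"])
      fix x
      have "norm (Q z (defect_operator (G z) x)) \<le> norm (Q z) * norm (defect_operator (G z) x)"
        by (rule norm_blinfun)
      also have "\<dots> \<le> r * norm (defect_operator (G z) x)" by (intro mult_right_mono r z) simp
      finally show "norm (Q z (defect_operator (G z) x)) \<le> r * norm (defect_operator (G z) x)" .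
    qed (use r eq[OF z] in simp_all)
    with r show "\<exists>r\<ge>0. \<forall>z\<in>\<D>. defect_dominated r (F z) (G z)"
      by (intro exI[of _ r]) simp
  qed
  finally show ?thesis .
qed

end
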